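(* For every $c_1$-digital image $X\subseteq\mathbb{Z}^n$, the homomorphisms $\beta_q: dC_q(X)\to C_q^{c_1}(X)$, $q\ge 0$, form a chain map, i.e. $\beta_{q-1}\circ\partial_q=\partial_q^{c_1}\circ\beta_q$ for all $q\ge 1$.
   Context: Two points of $\mathbb{Z}^n$ are $c_1$-adjacent if they differ by exactly $1$ in one coordinate and agree in all others. A $c_1$-digital image is a subset $X\subseteq\mathbb{Z}^n$ with this adjacency. A function between digital images is continuous if adjacent points map to equal or adjacent points. Let $I=\{0,1\}$, $I^q\subset\mathbb{Z}^q$ with $c_1$-adjacency. A singular $q$-cube in $X$ is a continuous map $\sigma:I^q\to X$. Singular complex: $dQ_q(X)$ is the free abelian group on all singular $q$-cubes in $X$; a $q$-cube is degenerate if for some $i\in\{1,\dots,q\}$ it does not depend on $t_i$; $dD_q(X)$ is the subgroup generated by degenerate $q$-cubes and $dC_q(X)=dQ_q(X)/dD_q(X)$. Faces: $A_i\sigma(t_1,\dots,t_{q-1})=\sigma(t_1,\dots,t_{i-1},0,t_i,\dots,t_{q-1})$ and $B_i\sigma(t_1,\dots,t_{q-1})=\sigma(t_1,\dots,t_{i-1},1,t_i,\dots,t_{q-1})$. The boundary is $\partial_q\sigma=\sum_{i=1}^q(-1)^i(A_i\sigma-B_i\sigma)$. $c_1$-complex: an elementary interval is $\{a\}$ (degenerate) or $\{a,a+1\}$ (nondegenerate), $a\in\mathbb{Z}$. An elementary $q$-cube is $Q=J_1\times\cdots\times J_n$ with $J_i$ elementary intervals, exactly $q$ of them nondegenerate.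 $C_q^{c_1}(X)$ is the free abelian group on the elementary $q$-cubes $Q\subseteq X$. $A_i^{c_1}Q$ (resp. $B_i^{c_1}Q$) is obtained by replacing $J_i$ with $\{\min J_i\}$ (resp. $\{\max J_i\}$). If $k_1<\dots<k_q$ are the indices with $J_{k_i}$ nondegenerate, $\partial_q^{c_1}Q=\sum_{i=1}^q(-1)^i(A_{k_i}^{c_1}Q-B_{k_i}^{c_1}Q)$. Orientation: let $\Sigma_q$ be the symmetric group; $\pi\in\Sigma_q$ acts on $I^q$ by $\pi(t_1,\dots,t_q)=(t_{\pi(1)},\dots,t_{\pi(q)})$; $\oplus$ is coordinatewise addition mod 2. An embedding matrix is an $n\times q$ matrix obtained by inserting $n-q$ zero rows into the $q\times q$ identity matrix. Every injective singular $q$-cube $\sigma$ is uniquely of the form $\sigma(t)=M(z\oplus\pi(t))+x$ with $M$ an embedding matrix, $z\in\mathbb{Z}_2^q$ (entries read as integers $0,1$), $\pi\in\Sigma_q$, $x\in X$; moreover its image $\sigma(I^q)$ is an elementary $q$-cube. Its orientation is $o^\sigma=(-1)^{\#z}(-1)^\pi$, where $\#z$ is the number of nonzero coordinates of $z$ and $(-1)^\pi$ is the sign of $\pi$. Definition of $\beta_q$ on generators: $\beta_q(\sigma)=0$ if $\sigma$ is noninjective, and $\beta_q(\sigma)=o^\sigma\cdot\sigma(I^q)$ if $\sigma$ is injective. *)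

theory Defs
  imports
    "HOL-Algebra.Free_Abelian_Groups"
    "HOL-Algebra.Generated_Groups"
    "HOL-Combinatorics.Permutations"
    "Jordan_Normal_Form.Matrix"
begin

text \<open>Points of \<open>\<int>\<^sup>n\<close> are the integer vectors in \<^term>\<open>carrier_vec n\<close>. Coordinates are
  numbered from 0, so the sign \<open>(-1)\<^sup>i\<close> attached to the \<open>i\<close>-th coordinate in the usual
  numbering \<open>1, \<dots>, q\<close> becomes \<open>(-1)\<^sup>i\<^sup>+\<^sup>1\<close> in the boundary formulas below.\<close>

definition c1_adjacent :: "int vec \<Rightarrow> int vec \<Rightarrow> bool" where
  "c1_adjacent x y \<longleftrightarrow> dim_vec x = dim_vec y \<and>
     (\<exists>i<dim_vec x. \<bar>x $ i - y $ i\<bar> = 1 \<and> (\<forall>j<dim_vec x. j \<noteq> i \<longrightarrow> x $ j = y $ j))"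

definition c1_continuous :: "int vec set \<Rightarrow> int vec set \<Rightarrow> (int vec \<Rightarrow> int vec) \<Rightarrow> bool" where
  "c1_continuous X Y f \<longleftrightarrow> f ` X \<subseteq> Y \<and>
     (\<forall>s\<in>X. \<forall>t\<in>X. c1_adjacent s t \<longrightarrow> f s = f t \<or> c1_adjacent (f s) (f t))"

definition Icube :: "nat \<Rightarrow> int vec set" where
  "Icube q = {t \<in> carrier_vec q. \<forall>i<q. t $ i \<in> {0, 1}}"


subsection \<open>The singular complex\<close>

text \<open>Maps on \<open>I\<^sup>q\<close> are represented by functions that are \<open>undefined\<close> off \<open>I\<^sup>q\<close>, so that
  equality of singular cubes is equality of HOL functions.\<close>

definition singular_cubes :: "int vec set \<Rightarrow> nat \<Rightarrow> (int vec \<Rightarrow> int vec) set" where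
  "singular_cubes X q = {\<sigma> \<in> extensional (Icube q). c1_continuous (Icube q) X \<sigma>}"

definition degenerate_cube :: "nat \<Rightarrow> (int vec \<Rightarrow> int vec) \<Rightarrow> bool" where
  "degenerate_cube q \<sigma> \<longleftrightarrow> (\<exists>i<q. \<forall>s\<in>Icube q. \<forall>t\<in>Icube q.
     (\<forall>j<q. j \<noteq> i \<longrightarrow> s $ j = t $ j) \<longrightarrow> \<sigma> s = \<sigma> t)"

definition dQ :: "int vec set \<Rightarrow> nat \<Rightarrow> ((int vec \<Rightarrow> int vec) \<Rightarrow>\<^sub>0 int) monoid" where
  "dQ X q = free_Abelian_group (singular_cubes X q)"

definition dD :: "int vec set \<Rightarrow> nat \<Rightarrow> ((int vec \<Rightarrow> int vec) \<Rightarrow>\<^sub>0 int) set" where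
  "dD X q = generate (dQ X q) (frag_of ` {\<sigma> \<in> singular_cubes X q. degenerate_cube q \<sigma>})"

definition dC :: "int vec set \<Rightarrow> nat \<Rightarrow> ((int vec \<Rightarrow> int vec) \<Rightarrow>\<^sub>0 int) set monoid" where
  "dC X q = dQ X q Mod dD X q"

definition insert_coord :: "nat \<Rightarrow> int \<Rightarrow> int vec \<Rightarrow> int vec" where
  "insert_coord i e t = vec (Suc (dim_vec t))
     (\<lambda>j. if j < i then t $ j else if j = i then e else t $ (j - 1))"

definition face_A :: "nat \<Rightarrow> nat \<Rightarrow> (int vec \<Rightarrow> int vec) \<Rightarrow> int vec \<Rightarrow> int vec" where
  "face_A q i \<sigma> = (\<lambda>t\<in>Icube (q - 1). \<sigma> (insert_coord i 0 t))"

definition face_B :: "nat \<Rightarrow> nat \<Rightarrow> (int vec \<Rightarrow> int vec) \<Rightarrow> int vec \<Rightarrow> int vec" where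
  "face_B q i \<sigma> = (\<lambda>t\<in>Icube (q - 1). \<sigma> (insert_coord i 1 t))"

definition boundary_dQ :: "nat \<Rightarrow> ((int vec \<Rightarrow> int vec) \<Rightarrow>\<^sub>0 int) \<Rightarrow> ((int vec \<Rightarrow> int vec) \<Rightarrow>\<^sub>0 int)" where
  "boundary_dQ q = frag_extend (\<lambda>\<sigma>. \<Sum>i<q.
     frag_cmul ((-1) ^ (i + 1)) (frag_of (face_A q i \<sigma>) - frag_of (face_B q i \<sigma>)))"

text \<open>The map induced on cosets by \<^term>\<open>boundary_dQ q\<close>; see \<open>boundary_dC_coset\<close> below for its
  well-definedness.\<close>

definition boundary_dC ::
    "int vec set \<Rightarrow> nat \<Rightarrow> ((int vec \<Rightarrow> int vec) \<Rightarrow>\<^sub>0 int) set \<Rightarrow> ((int vec \<Rightarrow> int vec) \<Rightarrow>\<^sub>0 int) set" where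
  "boundary_dC X q K =
     the_elem ((\<lambda>c. dD X (q - 1) #>\<^bsub>dQ X (q - 1)\<^esub> boundary_dQ q c) ` K)"


subsection \<open>The \<open>c\<^sub>1\<close>-complex\<close>

definition degenerate_interval :: "int set \<Rightarrow> bool" where
  "degenerate_interval J \<longleftrightarrow> (\<exists>a. J = {a})"

definition nondegenerate_interval :: "int set \<Rightarrow> bool" where
  "nondegenerate_interval J \<longleftrightarrow> (\<exists>a. J = {a, a + 1})"

definition interval_box :: "nat \<Rightarrow> (nat \<Rightarrow> int set) \<Rightarrow> int vec set" where
  "interval_box n J = {x \<in> carrier_vec n. \<forall>i<n. x $ i \<in> J i}"

definition elementary_cubes :: "nat \<Rightarrow> nat \<Rightarrow> int vec set set" where
  "elementary_cubes n q = {interval_box n J | J.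
     (\<forall>i<n. degenerate_interval (J i) \<or> nondegenerate_interval (J i)) \<and>
     card {i. i < n \<and> nondegenerate_interval (J i)} = q}"

text \<open>An elementary cube is a set of points; its factor \<open>J\<^sub>i\<close> is recovered as the projection to
  the \<open>i\<close>-th coordinate.\<close>

definition cube_factor :: "int vec set \<Rightarrow> nat \<Rightarrow> int set" where
  "cube_factor Q i = (\<lambda>x. x $ i) ` Q"

definition c1_face_A :: "nat \<Rightarrow> nat \<Rightarrow> int vec set \<Rightarrow> int vec set" where
  "c1_face_A n i Q = interval_box n ((cube_factor Q)(i := {Min (cube_factor Q i)}))"

definition c1_face_B :: "nat \<Rightarrow> nat \<Rightarrow> int vec set \<Rightarrow> int vec set" where
  "c1_face_B n i Q = interval_box n ((cube_factor Q)(i := {Max (cube_factor Q i)}))"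

definition nondeg_index :: "nat \<Rightarrow> int vec set \<Rightarrow> nat \<Rightarrow> nat" where
  "nondeg_index n Q i = sorted_list_of_set {k. k < n \<and> nondegenerate_interval (cube_factor Q k)} ! i"

definition C_c1 :: "nat \<Rightarrow> int vec set \<Rightarrow> nat \<Rightarrow> (int vec set \<Rightarrow>\<^sub>0 int) monoid" where
  "C_c1 n X q = free_Abelian_group {Q \<in> elementary_cubes n q. Q \<subseteq> X}"

definition boundary_c1 :: "nat \<Rightarrow> nat \<Rightarrow> (int vec set \<Rightarrow>\<^sub>0 int) \<Rightarrow> (int vec set \<Rightarrow>\<^sub>0 int)" where
  "boundary_c1 n q = frag_extend (\<lambda>Q. \<Sum>i<q. frag_cmul ((-1) ^ (i + 1))
     (frag_of (c1_face_A n (nondeg_index n Q i) Q) - frag_of (c1_face_B n (nondeg_index n Q i) Q)))"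


subsection \<open>Orientation and the map \<open>\<beta>\<close>\<close>

definition embedding_matrix :: "nat \<Rightarrow> nat \<Rightarrow> int mat \<Rightarrow> bool" where
  "embedding_matrix n q M \<longleftrightarrow> (\<exists>k. strict_mono_on {..<q} k \<and> k ` {..<q} \<subseteq> {..<n} \<and>
     M = mat n q (\<lambda>(i, j). if i = k j then 1 else 0))"

definition perm_vec :: "(nat \<Rightarrow> nat) \<Rightarrow> int vec \<Rightarrow> int vec" where
  "perm_vec \<pi> t = vec (dim_vec t) (\<lambda>i. t $ \<pi> i)"

definition add_mod2 :: "int vec \<Rightarrow> int vec \<Rightarrow> int vec" where
  "add_mod2 z t = vec (dim_vec t) (\<lambda>i. (z $ i + t $ i) mod 2)"

definition standard_form ::
    "nat \<Rightarrow> int vec set \<Rightarrow> nat \<Rightarrow> (int vec \<Rightarrow> int vec) \<Rightarrow>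
     int mat \<Rightarrow> int vec \<Rightarrow> (nat \<Rightarrow> nat) \<Rightarrow> int vec \<Rightarrow> bool" where
  "standard_form n X q \<sigma> M z \<pi> x \<longleftrightarrow>
     embedding_matrix n q M \<and> z \<in> Icube q \<and> \<pi> permutes {..<q} \<and> x \<in> X \<and>
     (\<forall>t\<in>Icube q. \<sigma> t = M *\<^sub>v add_mod2 z (perm_vec \<pi> t) + x)"

definition orientation :: "nat \<Rightarrow> int vec set \<Rightarrow> nat \<Rightarrow> (int vec \<Rightarrow> int vec) \<Rightarrow> int" where
  "orientation n X q \<sigma> = (THE s. \<exists>M z \<pi> x. standard_form n X q \<sigma> M z \<pi> x \<and>
     s = (-1) ^ card {i. i < q \<and> z $ i \<noteq> 0} * sign \<pi>)"

definition beta_dQ ::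
    "nat \<Rightarrow> int vec set \<Rightarrow> nat \<Rightarrow> ((int vec \<Rightarrow> int vec) \<Rightarrow>\<^sub>0 int) \<Rightarrow> (int vec set \<Rightarrow>\<^sub>0 int)" where
  "beta_dQ n X q = frag_extend (\<lambda>\<sigma>. if inj_on \<sigma> (Icube q)
     then frag_cmul (orientation n X q \<sigma>) (frag_of (\<sigma> ` Icube q)) else 0)"

text \<open>The map induced on cosets by \<^term>\<open>beta_dQ n X q\<close>; see \<open>beta_coset\<close> below for its
  well-definedness.\<close>

definition beta ::
    "nat \<Rightarrow> int vec set \<Rightarrow> nat \<Rightarrow> ((int vec \<Rightarrow> int vec) \<Rightarrow>\<^sub>0 int) set \<Rightarrow> (int vec set \<Rightarrow>\<^sub>0 int)" where
  "beta n X q K = the_elem (beta_dQ n X q ` K)"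


subsection \<open>Well-definedness on cosets\<close>

lemma insert_coord_Icube:
  assumes "t \<in> Icube (q - 1)" "i < q" "e \<in> {0, 1}"
  shows "insert_coord i e t \<in> Icube q"
proof -
  have t: "dim_vec t = q - 1" "\<And>j. j < q - 1 \<Longrightarrow> t $ j = 0 \<or> t $ j = 1"
    using assms(1) by (auto simp: Icube_def)
  have "insert_coord i e t $ j \<in> {0, 1}" if "j < q" for j
    using t(1) t(2)[of j] t(2)[of "j - 1"] that assms(2,3)
    by (cases "j < i"; cases "j = i") (auto simp: insert_coord_def)
  moreover have "insert_coord i e t \<in> carrier_vec q"
    using t(1) assms(2) by (intro carrier_vecI) (simp add: insert_coord_def)
  ultimately show ?thesis by (simp add: Icube_def)
qed

lemma insert_coord_adjacent:
  assumes "c1_adjacent s t" "i \<le> dim_vec s"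
  shows "c1_adjacent (insert_coord i e s) (insert_coord i e t)"
proof -
  obtain k where d: "dim_vec s = dim_vec t" and k: "k < dim_vec s" "\<bar>s $ k - t $ k\<bar> = 1"
    and eq: "\<And>j. j < dim_vec s \<Longrightarrow> j \<noteq> k \<Longrightarrow> s $ j = t $ j"
    using assms(1) by (auto simp: c1_adjacent_def)
  define k' where "k' = (if k < i then k else Suc k)"
  have "k' < Suc (dim_vec s)" using k by (auto simp: k'_def)
  moreover have "\<bar>insert_coord i e s $ k' - insert_coord i e t $ k'\<bar> = 1"
    using k d by (auto simp: k'_def insert_coord_def)
  moreover have "insert_coord i e s $ j = insert_coord i e t $ j"
    if "j < Suc (dim_vec s)" "j \<noteq> k'" for j
    using that d eq[of j] eq[of "j - 1"] assms(2) by (auto simp: k'_def insert_coord_def split: if_splits)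
  ultimately show ?thesis
    unfolding c1_adjacent_def
    by (intro conjI exI[of _ k']) (use d in \<open>auto simp: insert_coord_def\<close>)
qed

lemma face_singular:
  assumes \<sigma>: "\<sigma> \<in> singular_cubes X q" and i: "i < q" and e: "e \<in> {0, 1}"
  shows "(\<lambda>t\<in>Icube (q - 1). \<sigma> (insert_coord i e t)) \<in> singular_cubes X (q - 1)"
proof -
  have I: "insert_coord i e t \<in> Icube q" if "t \<in> Icube (q - 1)" for t
    using insert_coord_Icube that i e by blast
  have "i \<le> dim_vec t" if "t \<in> Icube (q - 1)" for t
    using that i by (auto simp: Icube_def)
  then show ?thesis
    using \<sigma> I insert_coord_adjacent
    unfolding singular_cubes_def c1_continuous_def by (simp add: image_subset_iff)
qed

lemma face_A_singular: "\<sigma> \<in> singular_cubes X q \<Longrightarrow> i < q \<Longrightarrow> face_A q i \<sigma> \<in> singular_cubes X (q - 1)"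
  and face_B_singular: "\<sigma> \<in> singular_cubes X q \<Longrightarrow> i < q \<Longrightarrow> face_B q i \<sigma> \<in> singular_cubes X (q - 1)"
  unfolding face_A_def face_B_def by (intro face_singular; simp)+

lemma face_degenerate:
  assumes k: "k < q" and i: "i < q" "i \<noteq> k" and e: "e \<in> {0, 1}"
    and deg: "\<And>s t. s \<in> Icube q \<Longrightarrow> t \<in> Icube q \<Longrightarrow> (\<forall>j<q. j \<noteq> k \<longrightarrow> s $ j = t $ j) \<Longrightarrow> \<sigma> s = \<sigma> t"
  shows "degenerate_cube (q - 1) (\<lambda>t\<in>Icube (q - 1). \<sigma> (insert_coord i e t))"
proof -
  define k' where "k' = (if k < i then k else k - 1)"
  have k': "k' < q - 1" using k i by (auto simp: k'_def)
  have eq: "\<sigma> (insert_coord i e s) = \<sigma> (insert_coord i e t)"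
    if s: "s \<in> Icube (q - 1)" and t: "t \<in> Icube (q - 1)"
      and st: "\<forall>j<q - 1. j \<noteq> k' \<longrightarrow> s $ j = t $ j" for s t
  proof (rule deg)
    show "insert_coord i e s \<in> Icube q" "insert_coord i e t \<in> Icube q"
      using insert_coord_Icube s t i e by blast+
    show "\<forall>j<q. j \<noteq> k \<longrightarrow> insert_coord i e s $ j = insert_coord i e t $ j"
    proof (intro allI impI)
      fix j assume j: "j < q" "j \<noteq> k"
      have d: "dim_vec s = q - 1" "dim_vec t = q - 1" using s t by (auto simp: Icube_def)
      consider "j < i" | "j = i" | "i < j" by linarith
      then show "insert_coord i e s $ j = insert_coord i e t $ j"
      proof cases
        case 1
        then have "j < q - 1" "j \<noteq> k'" using i j by (auto simp: k'_def)
        then show ?thesis using st j d 1 by (auto simp: insert_coord_def)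
      next
        case 2
        then show ?thesis using j d by (auto simp: insert_coord_def)
      next
        case 3
        then have "j - 1 < q - 1" "j - 1 \<noteq> k'" using i j by (auto simp: k'_def)
        then show ?thesis using st j d 3 by (auto simp: insert_coord_def)
      qed
    qed
  qed
  show ?thesis
    unfolding degenerate_cube_def
  proof (intro exI[of _ k'] conjI k' ballI impI)
    fix s t assume st: "s \<in> Icube (q - 1)" "t \<in> Icube (q - 1)"
      "\<forall>j<q - 1. j \<noteq> k' \<longrightarrow> s $ j = t $ j"
    show "(\<lambda>t\<in>Icube (q - 1). \<sigma> (insert_coord i e t)) s = (\<lambda>t\<in>Icube (q - 1). \<sigma> (insert_coord i e t)) t"
      using eq[OF st] st(1,2) by simp
  qed
qed

lemma faces_eq_degenerate:
  assumes k: "k < q"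
    and deg: "\<And>s t. s \<in> Icube q \<Longrightarrow> t \<in> Icube q \<Longrightarrow> (\<forall>j<q. j \<noteq> k \<longrightarrow> s $ j = t $ j) \<Longrightarrow> \<sigma> s = \<sigma> t"
  shows "face_A q k \<sigma> = face_B q k \<sigma>"
  unfolding face_A_def face_B_def
proof (rule restrict_ext)
  fix t assume t: "t \<in> Icube (q - 1)"
  show "\<sigma> (insert_coord k 0 t) = \<sigma> (insert_coord k 1 t)"
  proof (rule deg)
    show "insert_coord k 0 t \<in> Icube q" "insert_coord k 1 t \<in> Icube q"
      using insert_coord_Icube t k by auto
    show "\<forall>j<q. j \<noteq> k \<longrightarrow> insert_coord k 0 t $ j = insert_coord k 1 t $ j"
      using t k by (auto simp: insert_coord_def Icube_def)
  qed
qed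

lemma dD_subgroup: "subgroup (dD X q) (dQ X q)"
  unfolding dD_def dQ_def
  by (rule group.generate_is_subgroup) (auto simp: keys_frag_of)

lemma dD_normal: "dD X q \<lhd> dQ X q"
  using abelian_free_Abelian_group comm_group.normal_iff_subgroup dD_subgroup dQ_def by metis

lemma dD_0: "0 \<in> dD X q"
  using subgroup.one_closed[OF dD_subgroup] by (simp add: dQ_def)

lemma dD_add: "a \<in> dD X q \<Longrightarrow> b \<in> dD X q \<Longrightarrow> a + b \<in> dD X q"
  using subgroup.m_closed[OF dD_subgroup] by (simp add: dQ_def)

lemma dD_carrier: "a \<in> dD X q \<Longrightarrow> a \<in> carrier (dQ X q)"
  using subgroup.subset[OF dD_subgroup] by auto

lemma dD_uminus: "a \<in> dD X q \<Longrightarrow> - a \<in> dD X q"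
  using subgroup.m_inv_closed[OF dD_subgroup] dD_carrier[of a X q]
  by (metis dQ_def inv_free_Abelian_group carrier_free_Abelian_group_iff)

lemma dD_sum: "(\<And>i. i \<in> I \<Longrightarrow> f i \<in> dD X q) \<Longrightarrow> sum f I \<in> dD X q"
  by (induction I rule: infinite_finite_induct) (auto simp: dD_0 dD_add)

lemma dD_frag_of: "\<sigma> \<in> singular_cubes X q \<Longrightarrow> degenerate_cube q \<sigma> \<Longrightarrow> frag_of \<sigma> \<in> dD X q"
  unfolding dD_def by (blast intro: generate.incl)

lemma dD_induct [consumes 1, case_names zero degenerate uminus add]:
  assumes "a \<in> dD X q" "P 0"
    and "\<And>\<sigma>. \<sigma> \<in> singular_cubes X q \<Longrightarrow> degenerate_cube q \<sigma> \<Longrightarrow> P (frag_of \<sigma>)"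
    and "\<And>a. P a \<Longrightarrow> P (- a)" "\<And>a b. P a \<Longrightarrow> P b \<Longrightarrow> P (a + b)"
  shows "P a"
  using assms(1) unfolding dD_def
proof (induction rule: generate.induct)
  case (inv h)
  then obtain \<sigma> where "h = frag_of \<sigma>" "\<sigma> \<in> singular_cubes X q" "degenerate_cube q \<sigma>" by auto
  then show ?case using assms(3,4) by (simp add: dQ_def keys_frag_of)
qed (use assms in \<open>auto simp: dQ_def\<close>)

lemma boundary_dQ_degenerate:
  assumes "\<sigma> \<in> singular_cubes X q" "degenerate_cube q \<sigma>"
  shows "boundary_dQ q (frag_of \<sigma>) \<in> dD X (q - 1)"
proof -
  obtain k where k: "k < q"
    and deg: "\<And>s t. s \<in> Icube q \<Longrightarrow> t \<in> Icube q \<Longrightarrow> (\<forall>j<q. j \<noteq> k \<longrightarrow> s $ j = t $ j) \<Longrightarrow> \<sigma> s = \<sigma> t"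
    using assms(2) unfolding degenerate_cube_def by meson
  have "frag_cmul ((-1) ^ (i + 1)) (frag_of (face_A q i \<sigma>) - frag_of (face_B q i \<sigma>)) \<in> dD X (q - 1)"
    if i: "i < q" for i
  proof (cases "i = k")
    case True
    then show ?thesis using faces_eq_degenerate[OF k deg] by (simp add: dD_0)
  next
    case False
    have A: "frag_of (face_A q i \<sigma>) \<in> dD X (q - 1)"
      by (rule dD_frag_of[OF face_A_singular[OF assms(1) i]], unfold face_A_def,
          rule face_degenerate[OF k i False _ deg]) simp_all
    have B: "frag_of (face_B q i \<sigma>) \<in> dD X (q - 1)"
      by (rule dD_frag_of[OF face_B_singular[OF assms(1) i]], unfold face_B_def,
          rule face_degenerate[OF k i False _ deg]) simp_all
    have d: "frag_of (face_A q i \<sigma>) - frag_of (face_B q i \<sigma>) \<in> dD X (q - 1)"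
      using dD_add[OF A dD_uminus[OF B]] by simp
    show ?thesis using d dD_uminus[OF d] by (cases "even i") simp_all
  qed
  then show ?thesis unfolding boundary_dQ_def by (auto intro: dD_sum)
qed

lemma boundary_dQ_dD: "a \<in> dD X q \<Longrightarrow> boundary_dQ q a \<in> dD X (q - 1)"
proof (induction rule: dD_induct)
  case (degenerate \<sigma>)
  then show ?case by (rule boundary_dQ_degenerate)
qed (simp_all add: boundary_dQ_def dD_0 dD_add dD_uminus frag_extend_minus frag_extend_add)

lemma boundary_dQ_carrier:
  assumes "c \<in> carrier (dQ X q)"
  shows "boundary_dQ q c \<in> carrier (dQ X (q - 1))"
proof -
  have keys: "Poly_Mapping.keys (\<Sum>i<q.
      frag_cmul ((-1) ^ (i + 1)) (frag_of (face_A q i \<sigma>) - frag_of (face_B q i \<sigma>)))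
      \<subseteq> singular_cubes X (q - 1)" if "\<sigma> \<in> singular_cubes X q" for \<sigma>
  proof (rule order_trans[OF keys_sum], intro UN_least order_trans[OF keys_cmul] order_trans[OF keys_diff])
    fix i assume "i \<in> {..<q}"
    then show "Poly_Mapping.keys (frag_of (face_A q i \<sigma>)) \<union> Poly_Mapping.keys (frag_of (face_B q i \<sigma>))
        \<subseteq> singular_cubes X (q - 1)"
      using that by (simp add: keys_frag_of face_A_singular face_B_singular del: One_nat_def)
  qed
  show ?thesis
    using assms keys unfolding boundary_dQ_def dQ_def carrier_free_Abelian_group_iff
    by (intro order_trans[OF keys_frag_extend] UN_least) blast
qed

lemma beta_dQ_dD: "a \<in> dD X q \<Longrightarrow> beta_dQ n X q a = 0"
proof (induction rule: dD_induct)
  case (degenerate \<sigma>)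
  then obtain k where k: "k < q"
    and deg: "\<And>s t. s \<in> Icube q \<Longrightarrow> t \<in> Icube q \<Longrightarrow> (\<forall>j<q. j \<noteq> k \<longrightarrow> s $ j = t $ j) \<Longrightarrow> \<sigma> s = \<sigma> t"
    unfolding degenerate_cube_def by meson
  let ?s = "0\<^sub>v q :: int vec" and ?t = "unit_vec q k :: int vec"
  have "?s \<in> Icube q" "?t \<in> Icube q" using k by (auto simp: Icube_def)
  moreover have "\<sigma> ?s = \<sigma> ?t" by (rule deg) (use k in \<open>auto simp: Icube_def\<close>)
  moreover have "?s \<noteq> ?t" using k by (metis index_unit_vec(1) index_zero_vec(1) zero_neq_one)
  ultimately have "\<not> inj_on \<sigma> (Icube q)" by (meson inj_onD)
  then show ?case by (simp add: beta_dQ_def)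
qed (simp_all add: beta_dQ_def frag_extend_minus frag_extend_add)

lemma dD_coset: "dD X q #>\<^bsub>dQ X q\<^esub> c = (\<lambda>h. h + c) ` dD X q"
  by (auto simp: r_coset_def dQ_def)

lemma the_elem_image_coset:
  assumes "\<And>h. h \<in> dD X q \<Longrightarrow> f (h + c) = f c"
  shows "the_elem (f ` (dD X q #>\<^bsub>dQ X q\<^esub> c)) = f c"
proof -
  have "f ` (dD X q #>\<^bsub>dQ X q\<^esub> c) = {f c}"
    using assms dD_0[of X q] by (force simp: dD_coset image_image)
  then show ?thesis by simp
qed

lemma boundary_dC_coset:
  assumes "c \<in> carrier (dQ X q)"
  shows "boundary_dC X q (dD X q #>\<^bsub>dQ X q\<^esub> c) = dD X (q - 1) #>\<^bsub>dQ X (q - 1)\<^esub> boundary_dQ q c"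
  unfolding boundary_dC_def
proof (rule the_elem_image_coset)
  fix h assume h: "h \<in> dD X q"
  let ?D = "dD X (q - 1)" and ?G = "dQ X (q - 1)"
  have G: "group ?G" by (simp add: dQ_def)
  have "boundary_dQ q (h + c) = boundary_dQ q h \<otimes>\<^bsub>?G\<^esub> boundary_dQ q c"
    by (simp add: boundary_dQ_def dQ_def frag_extend_add)
  moreover have "?D #>\<^bsub>?G\<^esub> (boundary_dQ q h \<otimes>\<^bsub>?G\<^esub> boundary_dQ q c) = ?D #>\<^bsub>?G\<^esub> boundary_dQ q c"
    using group.coset_mult_assoc[OF G subgroup.subset[OF dD_subgroup]
        dD_carrier[OF boundary_dQ_dD[OF h]] boundary_dQ_carrier[OF assms]]
      group.coset_join2[OF G dD_carrier[OF boundary_dQ_dD[OF h]] dD_subgroup boundary_dQ_dD[OF h]]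
    by simp
  ultimately show "?D #>\<^bsub>?G\<^esub> boundary_dQ q (h + c) = ?D #>\<^bsub>?G\<^esub> boundary_dQ q c" by simp
qed

lemma beta_coset: "beta n X q (dD X q #>\<^bsub>dQ X q\<^esub> c) = beta_dQ n X q c"
  unfolding beta_def
proof (rule the_elem_image_coset)
  fix h assume "h \<in> dD X q"
  then show "beta_dQ n X q (h + c) = beta_dQ n X q c"
    using beta_dQ_dD[of h X q n] by (simp add: beta_dQ_def frag_extend_add)
qed

end

theory Submission
  imports Defs
begin

text \<open>An injective singular cube is affine, \<open>\<sigma> t = x + (\<Sum>j<q. s\<^sub>j t\<^sub>j e\<^bsub>l j\<^esub>)\<close> with \<open>l\<close> injective and
  \<open>s\<^sub>j = \<plusminus>1\<close>, since it maps every square to a square. Its orientation is \<open>\<Prod>s\<^sub>j\<close> times the inversion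
  parity of \<open>l\<close>, and \<open>\<beta>\<close> commutes with the boundary on it because deleting the \<open>i\<close>-th entry of \<open>l\<close>
  changes that parity by \<open>i\<close> plus the rank of \<open>l i\<close>.

  For a noninjective \<open>q\<close>-cube \<open>\<sigma>\<close> one must show that \<open>w = \<beta> (\<partial> \<sigma>)\<close> vanishes. By induction on the
  dimension and \<open>\<partial> \<partial> = 0\<close>, \<open>w\<close> is a \<open>(q - 1)\<close>-cycle of elementary cubes whose vertices lie in the
  image of \<open>\<sigma>\<close>, hence with fewer than \<open>2\<^sup>q\<close> vertices. But a nonzero \<open>(q - 1)\<close>-cycle has at least
  \<open>2\<^sup>q\<close> vertices: slicing it between two parallel lattice hyperplanes gives a nonzero
  \<open>(q - 2)\<close>-cycle, whose vertices occur on both hyperplanes.\<close>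

section \<open>Sums over a finite set of indices with their ranks\<close>

text \<open>The \<open>i\<close>-th entry of the sorted list has exactly \<open>i\<close> smaller
  elements in \<open>K\<close>. This replaces positions in a list, as in \<open>boundary_c1\<close>,
  by ranks in a set, which behave well when an element is removed.\<close>

lemma sum_by_rank:
  fixes K :: "nat set" and f :: "nat \<Rightarrow> nat \<Rightarrow> 'a::comm_monoid_add"
  assumes "finite K"
  shows "(\<Sum>i<card K. f i (sorted_list_of_set K ! i)) = (\<Sum>k\<in>K. f (card {j \<in> K. j < k}) k)"
proof -
  let ?l = "sorted_list_of_set K"
  have len: "length ?l = card K" and set: "set ?l = K" and dist: "distinct ?l"
    using assms by auto
  have bij: "bij_betw ((!) ?l) {..<card K} K"
    using bij_betw_nth[OF dist refl, of K] len set by simp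
  have mono: "?l ! i < ?l ! j \<longleftrightarrow> i < j" if "i < card K" "j < card K" for i j
    using that strict_sorted_list_of_set[of K] len
    by (metis linorder_neqE_nat not_less_iff_gr_or_eq sorted_wrt_nth_less)
  have "card {j \<in> K. j < ?l ! i} = i" if i: "i < card K" for i
  proof -
    have "{j \<in> K. j < ?l ! i} = (!) ?l ` {..<i}"
    proof (intro Set.set_eqI iffI)
      fix j assume j: "j \<in> {j \<in> K. j < ?l ! i}"
      then obtain m where m: "m < card K" "j = ?l ! m"
        using bij by (auto simp: bij_betw_def)
      then show "j \<in> (!) ?l ` {..<i}"
        using mono[of m i] i j by simp
    next
      fix j assume "j \<in> (!) ?l ` {..<i}"
      then obtain m where m: "m < i" "j = ?l ! m" by auto
      then show "j \<in> {j \<in> K. j < ?l ! i}"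
        using mono[of m i] i bij by (auto simp: bij_betw_def)
    qed
    moreover have "inj_on ((!) ?l) {..<i}"
      using bij i by (auto simp: bij_betw_def intro: inj_on_subset)
    ultimately show ?thesis by (simp add: card_image)
  qed
  then have "(\<Sum>i<card K. f i (?l ! i)) = (\<Sum>i<card K. f (card {j \<in> K. j < ?l ! i}) (?l ! i))"
    by simp
  also have "\<dots> = (\<Sum>k\<in>K. f (card {j \<in> K. j < k}) k)"
    using bij by (rule sum.reindex_bij_betw)
  finally show ?thesis .
qed


subsection \<open>Elementary cubes\<close>

text \<open>Least corner \<open>b\<close> and set \<open>K\<close> of nondegenerate directions serve
  as coordinates for elementary cubes: faces become a function update and the removal of an element.
  Only the values of \<open>b\<close> below \<open>n\<close> matter.\<close>

definition ecube :: "nat \<Rightarrow> (nat \<Rightarrow> int) \<Rightarrow> nat set \<Rightarrow> int vec set" where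
  "ecube n b K = interval_box n (\<lambda>i. if i \<in> K then {b i, b i + 1} else {b i})"

lemma ecube_iff:
  "x \<in> ecube n b K \<longleftrightarrow> x \<in> carrier_vec n \<and> (\<forall>i<n. x $ i = b i \<or> i \<in> K \<and> x $ i = b i + 1)"
  by (auto simp: ecube_def interval_box_def)

lemma ecube_cong: "(\<And>i. i < n \<Longrightarrow> b i = b' i) \<Longrightarrow> ecube n b K = ecube n b' K"
  by (auto simp: ecube_iff)

lemma cube_factor_ecube:
  assumes "i < n"
  shows "cube_factor (ecube n b K) i = (if i \<in> K then {b i, b i + 1} else {b i})"
proof -
  have "vec n b \<in> ecube n b K" "i \<in> K \<Longrightarrow> vec n (b(i := b i + 1)) \<in> ecube n b K"
    by (auto simp: ecube_iff)
  then have "b i \<in> cube_factor (ecube n b K) i"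
    "i \<in> K \<Longrightarrow> b i + 1 \<in> cube_factor (ecube n b K) i"
    unfolding cube_factor_def using assms by (force intro: rev_image_eqI)+
  moreover have "cube_factor (ecube n b K) i \<subseteq> (if i \<in> K then {b i, b i + 1} else {b i})"
    using assms by (auto simp: cube_factor_def ecube_iff)
  ultimately show ?thesis by auto
qed

lemma nondegenerate_interval_simps [simp]:
  "nondegenerate_interval {a, a + 1}" "\<not> nondegenerate_interval {a}"
  by (auto simp: nondegenerate_interval_def)

lemma nondegenerate_ecube:
  "i < n \<Longrightarrow> nondegenerate_interval (cube_factor (ecube n b K) i) \<longleftrightarrow> i \<in> K"
  by (simp add: cube_factor_ecube)

lemma interval_box_cube_factor_upd:
  assumes "i < n"
  shows "interval_box n ((cube_factor (ecube n b K))(i := {c})) = ecube n (b(i := c)) (K - {i})"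
  using assms by (auto simp: interval_box_def ecube_iff cube_factor_ecube split: if_splits)

lemma c1_face_A_ecube: "i \<in> K \<Longrightarrow> i < n \<Longrightarrow> c1_face_A n i (ecube n b K) = ecube n b (K - {i})"
  by (simp add: c1_face_A_def interval_box_cube_factor_upd) (simp add: cube_factor_ecube)

lemma c1_face_B_ecube:
  "i \<in> K \<Longrightarrow> i < n \<Longrightarrow> c1_face_B n i (ecube n b K) = ecube n (b(i := b i + 1)) (K - {i})"
  by (simp add: c1_face_B_def interval_box_cube_factor_upd) (simp add: cube_factor_ecube)

lemma elementary_cubes_eq: "elementary_cubes n q = {ecube n b K | b K. K \<subseteq> {..<n} \<and> card K = q}"
proof (intro Set.set_eqI iffI)
  fix Q assume "Q \<in> elementary_cubes n q"
  then obtain J where Q: "Q = interval_box n J" and q: "card {i. i < n \<and> nondegenerate_interval (J i)} = q"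
    and J: "\<And>i. i < n \<Longrightarrow> degenerate_interval (J i) \<or> nondegenerate_interval (J i)"
    by (auto simp: elementary_cubes_def)
  define K where "K = {i. i < n \<and> nondegenerate_interval (J i)}"
  have "\<exists>a. J i = (if i \<in> K then {a, a + 1} else {a})" if "i < n" for i
    using J[OF that] that unfolding K_def degenerate_interval_def nondegenerate_interval_def by auto
  then obtain b where "\<And>i. i < n \<Longrightarrow> J i = (if i \<in> K then {b i, b i + 1} else {b i})" by metis
  then have "Q = ecube n b K" by (auto simp: Q ecube_def interval_box_def)
  then show "Q \<in> {ecube n b K | b K. K \<subseteq> {..<n} \<and> card K = q}"
    using q by (auto simp: K_def)
next
  fix Q assume "Q \<in> {ecube n b K | b K. K \<subseteq> {..<n} \<and> card K = q}"
  then obtain b K where Q: "Q = ecube n b K" "K \<subseteq> {..<n}" "card K = q" by blast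
  define J where "J = (\<lambda>i. if i \<in> K then {b i, b i + 1} else {b i})"
  have "{i. i < n \<and> nondegenerate_interval (J i)} = K"
    using Q(2) by (auto simp: J_def)
  moreover have "degenerate_interval (J i) \<or> nondegenerate_interval (J i)" for i
    by (simp add: J_def degenerate_interval_def)
  moreover have "Q = interval_box n J"
    by (simp only: Q(1) ecube_def J_def)
  ultimately show "Q \<in> elementary_cubes n q"
    unfolding elementary_cubes_def using Q(3) by blast
qed

lemma ecube_nonempty: "vec n b \<in> ecube n b K"
  by (simp add: ecube_iff)

text \<open>A point of the cube is determined by the set of coordinates at which it takes the upper
  value.\<close>

lemma finite_ecube: "finite (ecube n b K)"
proof (rule finite_subset)
  show "ecube n b K \<subseteq> (\<lambda>A. vec n (\<lambda>i. b i + (if i \<in> A then 1 else 0))) ` Pow {..<n}"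
  proof
    fix x assume x: "x \<in> ecube n b K"
    then have "x = vec n (\<lambda>i. b i + (if i \<in> {i. i < n \<and> x $ i = b i + 1} then 1 else 0))"
      by (intro eq_vecI) (auto simp: ecube_iff)
    then show "x \<in> (\<lambda>A. vec n (\<lambda>i. b i + (if i \<in> A then 1 else 0))) ` Pow {..<n}"
      by (rule image_eqI) auto
  qed
qed simp

text \<open>The form of the boundary used from here on: the sign of a face is read off from the rank
  of its direction \<open>k\<close> in \<open>K\<close>.\<close>

lemma boundary_c1_ecube:
  assumes "K \<subseteq> {..<n}"
  shows "boundary_c1 n (card K) (frag_of (ecube n b K)) =
    (\<Sum>k\<in>K. frag_cmul ((-1) ^ (card {j \<in> K. j < k} + 1))
       (frag_of (ecube n b (K - {k})) - frag_of (ecube n (b(k := b k + 1)) (K - {k}))))"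
proof -
  let ?f = "\<lambda>i k. frag_cmul ((-1) ^ (i + 1))
     (frag_of (c1_face_A n k (ecube n b K)) - frag_of (c1_face_B n k (ecube n b K)))"
  have fin: "finite K" using assms finite_subset by blast
  have "{k. k < n \<and> nondegenerate_interval (cube_factor (ecube n b K) k)} = K"
    using assms by (auto simp: nondegenerate_ecube)
  then have "boundary_c1 n (card K) (frag_of (ecube n b K)) = (\<Sum>i<card K. ?f i (sorted_list_of_set K ! i))"
    by (simp add: boundary_c1_def nondeg_index_def)
  also have "\<dots> = (\<Sum>k\<in>K. ?f (card {j \<in> K. j < k}) k)"
    by (rule sum_by_rank[OF fin])
  also have "\<dots> = (\<Sum>k\<in>K. frag_cmul ((-1) ^ (card {j \<in> K. j < k} + 1))
       (frag_of (ecube n b (K - {k})) - frag_of (ecube n (b(k := b k + 1)) (K - {k}))))"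
    using assms by (intro sum.cong) (auto simp: c1_face_A_ecube c1_face_B_ecube subset_iff)
  finally show ?thesis .
qed

section \<open>Linear extensions and the coordinates of a cube\<close>

lemma frag_extend_frag_extend:
  "frag_extend f (frag_extend g w) = frag_extend (\<lambda>x. frag_extend f (g x)) w"
  by (simp add: frag_extend_def[of g] frag_extend_def[of "\<lambda>x. frag_extend f (g x)"]
      frag_extend_sum frag_extend_cmul o_def)

lemma lookup_frag_extend:
  "Poly_Mapping.lookup (frag_extend f w) y =
    (\<Sum>x\<in>Poly_Mapping.keys w. Poly_Mapping.lookup w x * Poly_Mapping.lookup (f x) y)"
  by (simp add: frag_extend_def lookup_sum)

lemma boundary_c1_frag_extend:
  "boundary_c1 n q (frag_extend f w) = frag_extend (\<lambda>x. boundary_c1 n q (f x)) w"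
  by (simp add: boundary_c1_def frag_extend_frag_extend)

lemma boundary_c1_expand:
  "boundary_c1 n q w = frag_extend (\<lambda>Q. boundary_c1 n q (frag_of Q)) w"
  by (simp add: boundary_c1_def)

text \<open>The projections of the cube recover the data: \<open>K\<close> from the nondegenerate
  factors, \<open>b\<close> from their lower endpoints. In \<open>slab_slice\<close> this excludes
  cancellation between different cubes.\<close>

lemma ecube_eqD:
  assumes "ecube n b K = ecube n b' K'" "K \<subseteq> {..<n}" "K' \<subseteq> {..<n}"
  shows "K = K'" "i < n \<Longrightarrow> b i = b' i"
proof -
  show KK: "K = K'"
    using assms nondegenerate_ecube[of _ n b K] nondegenerate_ecube[of _ n b' K'] by auto
  show "b i = b' i" if "i < n"
    using cube_factor_ecube[OF that, of b K] cube_factor_ecube[OF that, of b' K'] assms(1) KK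
    by (auto simp: doubleton_eq_iff split: if_splits)
qed


subsection \<open>Cycles of elementary cubes have many vertices\<close>

text \<open>Extended linearly, this intersects a chain with the slab between the hyperplanes at
  heights \<open>m\<close> and \<open>m + 1\<close> in direction \<open>k\<close>. Pushing the
  section down to the lower hyperplane keeps it an elementary cube.\<close>

definition slab_face :: "nat \<Rightarrow> nat \<Rightarrow> int \<Rightarrow> int vec set \<Rightarrow> (int vec set \<Rightarrow>\<^sub>0 int)" where
  "slab_face n k m Q = (if cube_factor Q k = {m, m + 1} then frag_of (c1_face_A n k Q) else 0)"

lemma slab_face_ecube:
  assumes "k < n"
  shows "slab_face n k m (ecube n b K) = (if k \<in> K \<and> b k = m then frag_of (ecube n b (K - {k})) else 0)"
  using assms by (auto simp: slab_face_def cube_factor_ecube c1_face_A_ecube doubleton_eq_iff)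

text \<open>Slicing along the last direction leaves the ranks of the other directions unchanged, so no
  sign appears.\<close>

lemma slab_face_boundary:
  assumes K: "K \<subseteq> {..<n}" "K \<subseteq> {..k}" "card K = Suc q" and k: "k < n"
  shows "frag_extend (slab_face n k m) (boundary_c1 n (Suc q) (frag_of (ecube n b K))) =
    boundary_c1 n q (slab_face n k m (ecube n b K))"
proof -
  have fin: "finite K" using K(1) finite_subset by blast
  let ?c = "\<lambda>K j. (-1::int) ^ (card {i \<in> K. i < j} + 1)"
  let ?S = "slab_face n k m"
  define T where "T = (\<lambda>j. frag_cmul (?c K j)
    (?S (ecube n b (K - {j})) - ?S (ecube n (b(j := b j + 1)) (K - {j}))))"
  have lhs: "frag_extend ?S (boundary_c1 n (Suc q) (frag_of (ecube n b K))) = sum T K"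
    using boundary_c1_ecube[OF K(1), of b] fin
    by (simp add: K(3) frag_extend_sum frag_extend_cmul frag_extend_diff o_def T_def)
  \<comment> \<open>Both faces in direction \<open>k\<close> are flat in that direction, so neither
    crosses the slab.\<close>
  have Tk: "T k = 0"
    using k by (simp add: T_def slab_face_ecube)
  show ?thesis
  proof (cases "k \<in> K \<and> b k = m")
    case True
    have T: "T j = frag_cmul (?c (K - {k}) j)
        (frag_of (ecube n b (K - {k} - {j})) - frag_of (ecube n (b(j := b j + 1)) (K - {k} - {j})))"
      if j: "j \<in> K - {k}" for j
    proof -
      have "{i \<in> K. i < j} = {i \<in> K - {k}. i < j}"
        using j K(2) by auto
      moreover have "K - {j} - {k} = K - {k} - {j}" by blast
      ultimately show ?thesis
        using j k True by (simp add: T_def slab_face_ecube)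
    qed
    have "sum T K = sum T (K - {k})"
      using sum.remove[OF fin, of k T] True Tk by simp
    also have "\<dots> = (\<Sum>j\<in>K - {k}. frag_cmul (?c (K - {k}) j)
        (frag_of (ecube n b (K - {k} - {j})) - frag_of (ecube n (b(j := b j + 1)) (K - {k} - {j}))))"
      by (rule sum.cong[OF refl T])
    also have "\<dots> = boundary_c1 n (card (K - {k})) (frag_of (ecube n b (K - {k})))"
      by (rule boundary_c1_ecube[symmetric]) (use K(1) in blast)
    also have "\<dots> = boundary_c1 n q (?S (ecube n b K))"
      using True k K(3) fin by (simp add: slab_face_ecube)
    finally show ?thesis using lhs by simp
  next
    case False
    have "T j = 0" if "j \<in> K" for j
      using that False k by (cases "j = k") (auto simp: Tk T_def slab_face_ecube)
    moreover have "boundary_c1 n q (?S (ecube n b K)) = 0"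
      using False k by (auto simp: slab_face_ecube boundary_c1_def)
    ultimately show ?thesis using lhs by simp
  qed
qed

text \<open>One dimension is traded for a factor two in the number of vertices. The bound on
  \<open>K\<close> is passed on because \<open>slab_face_boundary\<close> asks for it.\<close>

lemma slab_slice:
  assumes w: "Poly_Mapping.keys w \<subseteq> elementary_cubes n (Suc q)" "w \<noteq> 0"
  obtains k m where "k < n"
    and "\<And>b K. ecube n b K \<in> Poly_Mapping.keys w \<Longrightarrow> K \<subseteq> {..<n} \<Longrightarrow> K \<subseteq> {..k}"
    and "frag_extend (slab_face n k m) w \<noteq> 0"
    and "Poly_Mapping.keys (frag_extend (slab_face n k m) w) \<subseteq> elementary_cubes n q"
    and "2 * card (\<Union>(Poly_Mapping.keys (frag_extend (slab_face n k m) w)))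
      \<le> card (\<Union>(Poly_Mapping.keys w))"
proof -
  let ?W = "Poly_Mapping.keys w"
  have W: "\<exists>b K. Q = ecube n b K \<and> K \<subseteq> {..<n} \<and> card K = Suc q" if "Q \<in> ?W" for Q
    using that w(1) unfolding elementary_cubes_eq by blast
  \<comment> \<open>\<open>D\<close> collects the directions of all cubes of \<open>w\<close>. Its
    maximum becomes \<open>k\<close>, so that no cube extends in a direction beyond
    \<open>k\<close>; the height \<open>m\<close> is taken from one cube that does extend along
    \<open>k\<close>, so the slab meets the chain.\<close>
  define D where "D = \<Union>{K. K \<subseteq> {..<n} \<and> (\<exists>b. ecube n b K \<in> ?W)}"
  obtain Q where "Q \<in> ?W" using w(2) by (metis all_not_in_conv keys_eq_empty)
  then obtain b1 K1 where "ecube n b1 K1 \<in> ?W" "K1 \<subseteq> {..<n}" "card K1 = Suc q" using W by blast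
  then have "D \<noteq> {}" unfolding D_def by (auto intro!: exI[of _ K1])
  moreover have "D \<subseteq> {..<n}" by (auto simp: D_def)
  ultimately have D: "finite D" "D \<noteq> {}" "D \<subseteq> {..<n}" by (auto intro: finite_subset)
  define k where "k = Max D"
  have "k \<in> D" using D by (simp add: k_def)
  then have k: "k < n" using D by auto
  obtain b0 K0 where K0: "ecube n b0 K0 \<in> ?W" "K0 \<subseteq> {..<n}" "k \<in> K0"
    using \<open>k \<in> D\<close> by (auto simp: D_def)
  define m where "m = b0 k"
  define d where "d = frag_extend (slab_face n k m) w"
  have le: "K \<subseteq> {..k}" if "ecube n b K \<in> ?W" "K \<subseteq> {..<n}" for b K
    using that D(1) by (auto simp: D_def k_def intro!: Max_ge)
  have dkeys: "\<exists>b K. R = ecube n b (K - {k}) \<and> ecube n b K \<in> ?W \<and> K \<subseteq> {..<n} \<and> k \<in> K \<and>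
      b k = m \<and> card K = Suc q" if R: "R \<in> Poly_Mapping.keys d" for R
  proof -
    obtain Q where Q: "Q \<in> ?W" "R \<in> Poly_Mapping.keys (slab_face n k m Q)"
      using R keys_frag_extend[of "slab_face n k m" w] by (auto simp: d_def)
    obtain b K where bK: "Q = ecube n b K" "K \<subseteq> {..<n}" "card K = Suc q" using W[OF Q(1)] by blast
    then have "k \<in> K" "b k = m" "R = ecube n b (K - {k})"
      using Q(2) k by (auto simp: slab_face_ecube split: if_splits)
    then show ?thesis using bK Q(1) by blast
  qed
  \<comment> \<open>\<open>?Q\<close> is the only cube of \<open>w\<close> with slice
    \<open>?R\<close>: the slice determines \<open>b\<close> and \<open>K - {k}\<close>, and
    \<open>k\<close> can be put back. Hence the coefficient of \<open>?R\<close> is that of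
    \<open>?Q\<close> and the slice does not vanish.\<close>
  let ?R = "ecube n b0 (K0 - {k})" and ?Q = "ecube n b0 K0"
  have other: "Poly_Mapping.lookup w Q * Poly_Mapping.lookup (slab_face n k m Q) ?R = 0"
    if Q: "Q \<in> ?W - {?Q}" for Q
  proof -
    obtain b K where bK: "Q = ecube n b K" "K \<subseteq> {..<n}" using W Q by blast
    have "ecube n b (K - {k}) \<noteq> ?R" if kK: "k \<in> K" "b k = m"
    proof
      assume eq: "ecube n b (K - {k}) = ?R"
      have "K - {k} = K0 - {k}" "\<And>i. i < n \<Longrightarrow> b i = b0 i"
        using ecube_eqD[OF eq] bK(2) K0(2) by auto
      then have "Q = ?Q" using bK(1) kK(1) K0(3) ecube_cong by (metis insert_Diff)
      then show False using Q by simp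
    qed
    then show ?thesis using bK(1) k by (auto simp: slab_face_ecube)
  qed
  have "(\<Sum>Q\<in>?W - {?Q}. Poly_Mapping.lookup w Q * Poly_Mapping.lookup (slab_face n k m Q) ?R) = 0"
    by (intro sum.neutral ballI other)
  then have "Poly_Mapping.lookup d ?R = Poly_Mapping.lookup w ?Q"
    using sum.remove[OF finite_keys K0(1),
        of "\<lambda>Q. Poly_Mapping.lookup w Q * Poly_Mapping.lookup (slab_face n k m Q) ?R"] k K0(3)
    by (simp add: d_def lookup_frag_extend slab_face_ecube m_def)
  then have d0: "d \<noteq> 0" using K0(1) by (metis in_keys_iff lookup_zero)
  have dq: "Poly_Mapping.keys d \<subseteq> elementary_cubes n q"
  proof
    fix R assume "R \<in> Poly_Mapping.keys d"
    then obtain b K where R: "R = ecube n b (K - {k})" "K \<subseteq> {..<n}" "k \<in> K" "card K = Suc q"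
      using dkeys by blast
    then have "finite K" using finite_subset by blast
    then show "R \<in> elementary_cubes n q"
      using R unfolding elementary_cubes_eq by (auto intro!: exI[of _ b] exI[of _ "K - {k}"])
  qed
  let ?U = "\<Union>?W" and ?V = "\<Union>(Poly_Mapping.keys d)"
  \<comment> \<open>A vertex of the slice has height \<open>m\<close>, its translate height
    \<open>m + 1\<close>. Both are vertices of \<open>w\<close>, which gives the factor two.\<close>
  define up where "up = (\<lambda>x::int vec. vec n (\<lambda>i. x $ i + (if i = k then 1 else 0)))"
  have V: "x \<in> ?U \<and> up x \<in> ?U \<and> x $ k = m \<and> x \<in> carrier_vec n" if x: "x \<in> ?V" for x
  proof -
    obtain R where R: "R \<in> Poly_Mapping.keys d" "x \<in> R" using x by blast
    obtain b K where bK: "R = ecube n b (K - {k})" "ecube n b K \<in> ?W" "k \<in> K" "b k = m"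
      using dkeys[OF R(1)] by blast
    then have "x \<in> ecube n b K" "up x \<in> ecube n b K" "x $ k = m" "x \<in> carrier_vec n"
      using R(2) k by (auto simp: ecube_iff up_def)
    then show ?thesis using bK(2) by blast
  qed
  have "finite ?U" using W finite_ecube by (metis finite_UN_I finite_keys image_ident)
  moreover have "?V \<union> up ` ?V \<subseteq> ?U" using V by blast
  ultimately have fin: "finite (?V \<union> up ` ?V)" "card (?V \<union> up ` ?V) \<le> card ?U"
    using finite_subset card_mono by metis+
  have "inj_on up ?V"
  proof (rule inj_onI)
    fix x y assume xy: "x \<in> ?V" "y \<in> ?V" "up x = up y"
    have "x $ i = y $ i" if "i < n" for i
      using arg_cong[OF xy(3), of "\<lambda>v. v $ i"] that by (simp add: up_def)
    then show "x = y" using V[OF xy(1)] V[OF xy(2)] by (intro eq_vecI) auto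
  qed
  moreover have "?V \<inter> up ` ?V = {}"
  proof (rule ccontr)
    assume "?V \<inter> up ` ?V \<noteq> {}"
    then obtain x where x: "x \<in> ?V" "up x \<in> ?V" by blast
    have "up x $ k = x $ k + 1" using k by (simp add: up_def)
    then show False using V[OF x(1)] V[OF x(2)] by linarith
  qed
  ultimately have "card (?V \<union> up ` ?V) = 2 * card ?V"
    using fin(1) by (simp add: card_Un_disjoint card_image)
  then have "2 * card ?V \<le> card ?U" using fin(2) by simp
  then show thesis using that[of k m] k le d0 dq unfolding d_def by blast
qed

text \<open>The extension of the constant \<open>frag_of ()\<close> is the augmentation: the sum of
  the coefficients, read in the free group on one generator. If it vanishes, the chain cannot be a
  nonzero multiple of a single point.\<close>

lemma augmented_cycle_vertices:
  assumes w: "Poly_Mapping.keys w \<subseteq> elementary_cubes n 0" "w \<noteq> 0"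
    and aug: "frag_extend (\<lambda>_. frag_of ()) w = 0"
  shows "2 \<le> card (\<Union>(Poly_Mapping.keys w))"
proof -
  let ?W = "Poly_Mapping.keys w"
  have W: "\<exists>x. Q = {x}" if Q: "Q \<in> ?W" for Q
  proof -
    obtain b K where Q: "Q = ecube n b K" "K \<subseteq> {..<n}" "card K = 0"
      using Q w(1) unfolding elementary_cubes_eq by blast
    have "finite K" using Q(2) finite_subset by blast
    then have "Q = {vec n b}" using Q by (auto simp: ecube_iff)
    then show ?thesis by blast
  qed
  have fin: "finite (\<Union>?W)" using W by (intro finite_Union) force+
  have sum0: "(\<Sum>Q\<in>?W. Poly_Mapping.lookup w Q) = 0"
    using arg_cong[OF aug, of "\<lambda>c. Poly_Mapping.lookup c ()"] by (simp add: lookup_frag_extend)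
  obtain Q where Q: "Q \<in> ?W" using w(2) by (metis all_not_in_conv keys_eq_empty)
  have "?W \<noteq> {Q}" using sum0 Q by (auto simp: in_keys_iff)
  then obtain R where R: "R \<in> ?W" "R \<noteq> Q" using Q by blast
  obtain x y where "Q = {x}" "R = {y}" using W Q R by blast
  then have "{x, y} \<subseteq> \<Union>?W" "card {x, y} = 2" using Q R by auto
  then show ?thesis using card_mono[OF fin] by metis
qed

text \<open>Counting \<open>1\<close> for the vertices above the slab computes the intersection number of a
  \<open>1\<close>-chain with the slab.\<close>

lemma slab_face_augmented:
  assumes "Q \<in> elementary_cubes n 1" "k < n"
  shows "frag_extend (\<lambda>R. if \<forall>x\<in>R. m < x $ k then frag_of () else 0) (boundary_c1 n 1 (frag_of Q)) =
    frag_extend (\<lambda>_. frag_of ()) (slab_face n k m Q)"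
proof -
  obtain b j where Q: "Q = ecube n b {j}" "j < n"
    using assms(1) unfolding elementary_cubes_eq by (auto simp: card_1_singleton_iff)
  \<comment> \<open>A 0-cube has a single vertex, so the quantifier only tests one
    coordinate.\<close>
  have h: "(\<forall>x\<in>ecube n b {}. m < x $ k) \<longleftrightarrow> m < b k" for b
    using assms(2) bspec[OF _ ecube_nonempty[of n b "{}"], of "\<lambda>x. m < x $ k"]
    by (auto simp: ecube_iff)
  have "boundary_c1 n 1 (frag_of Q) = frag_of (ecube n (b(j := b j + 1)) {}) - frag_of (ecube n b {})"
    using boundary_c1_ecube[of "{j}" n b] Q by (simp cong: conj_cong)
  \<comment> \<open>The end points lie on different sides of the slab exactly when
    \<open>j = k\<close> and \<open>b k = m\<close>.\<close>
  then show ?thesis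
    using assms(2) Q by (auto simp: frag_extend_diff h slab_face_ecube)
qed

text \<open>Induction on the dimension: a slice is again a nonzero cycle and has at most half the
  vertices. In the base case the slice is a 0-chain, where \<open>boundary_c1 n 0\<close> is zero
  anyway, so the augmentation takes the place of the boundary. The boundary of a
  \<open>(q + 2)\<close>-cube attains the bound.\<close>

lemma cycle_vertices:
  assumes "Poly_Mapping.keys w \<subseteq> elementary_cubes n (Suc q)" "boundary_c1 n (Suc q) w = 0" "w \<noteq> 0"
  shows "2 ^ (q + 2) \<le> card (\<Union>(Poly_Mapping.keys w))"
  using assms
proof (induction q arbitrary: w)
  case 0
  obtain k m where k: "k < n" and d: "frag_extend (slab_face n k m) w \<noteq> 0"
      "Poly_Mapping.keys (frag_extend (slab_face n k m) w) \<subseteq> elementary_cubes n 0"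
    and card: "2 * card (\<Union>(Poly_Mapping.keys (frag_extend (slab_face n k m) w)))
      \<le> card (\<Union>(Poly_Mapping.keys w))"
    using slab_slice[OF 0(1,3)] by metis
  have "frag_extend (\<lambda>_. frag_of ()) (frag_extend (slab_face n k m) w) =
    frag_extend (\<lambda>Q. frag_extend (\<lambda>R. if \<forall>x\<in>R. m < x $ k then frag_of () else 0)
      (boundary_c1 n 1 (frag_of Q))) w"
    unfolding frag_extend_frag_extend
    using 0(1) k by (intro frag_extend_eq slab_face_augmented[symmetric]) auto
  also have "\<dots> = frag_extend (\<lambda>R. if \<forall>x\<in>R. m < x $ k then frag_of () else 0) (boundary_c1 n 1 w)"
    by (subst boundary_c1_expand[of n 1 w]) (simp add: frag_extend_frag_extend)
  also have "\<dots> = 0" using 0(2) by simp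
  finally show ?case using augmented_cycle_vertices[OF d(2,1)] card by simp
next
  case (Suc q)
  obtain k m where k: "k < n"
    and le: "\<And>b K. ecube n b K \<in> Poly_Mapping.keys w \<Longrightarrow> K \<subseteq> {..<n} \<Longrightarrow> K \<subseteq> {..k}"
    and d: "frag_extend (slab_face n k m) w \<noteq> 0"
      "Poly_Mapping.keys (frag_extend (slab_face n k m) w) \<subseteq> elementary_cubes n (Suc q)"
    and card: "2 * card (\<Union>(Poly_Mapping.keys (frag_extend (slab_face n k m) w)))
      \<le> card (\<Union>(Poly_Mapping.keys w))"
    using slab_slice[OF Suc.prems(1,3)] by metis
  have "boundary_c1 n (Suc q) (slab_face n k m Q) =
    frag_extend (slab_face n k m) (boundary_c1 n (Suc (Suc q)) (frag_of Q))"
    if Q: "Q \<in> Poly_Mapping.keys w" for Q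
  proof -
    obtain b K where "Q = ecube n b K" "K \<subseteq> {..<n}" "card K = Suc (Suc q)"
      using Suc.prems(1) Q unfolding elementary_cubes_eq by blast
    then show ?thesis using slab_face_boundary[of K n k "Suc q" m b] le Q k by simp
  qed
  then have "boundary_c1 n (Suc q) (frag_extend (slab_face n k m) w) =
    frag_extend (\<lambda>Q. frag_extend (slab_face n k m) (boundary_c1 n (Suc (Suc q)) (frag_of Q))) w"
    unfolding boundary_c1_frag_extend by (intro frag_extend_eq)
  also have "\<dots> = frag_extend (slab_face n k m) (boundary_c1 n (Suc (Suc q)) w)"
    by (simp add: frag_extend_frag_extend boundary_c1_expand[of n "Suc (Suc q)" w])
  also have "\<dots> = 0" using Suc.prems(2) by simp
  finally show ?case using Suc.IH[OF d(2) _ d(1)] card by simp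
qed


subsection \<open>The sign of an injection\<close>

definition ord_pairs :: "nat \<Rightarrow> (nat \<times> nat) set" where
  "ord_pairs q = {(i, j). i < j \<and> j < q}"

text \<open>If \<open>l = k \<circ> p\<^sup>-\<^sup>1\<close> with \<open>k\<close> increasing and \<open>p\<close> a permutation, then the inversion parity of
  \<open>l\<close> is the sign of \<open>p\<close>; it does not mention the sorting permutation, which makes it easy to
  restrict to faces.\<close>

definition inv_sign :: "nat \<Rightarrow> (nat \<Rightarrow> nat) \<Rightarrow> int" where
  "inv_sign q l = (\<Prod>(i, j)\<in>ord_pairs q. sgn (int (l j) - int (l i)))"

lemma finite_ord_pairs [simp]: "finite (ord_pairs q)"
  by (rule finite_subset[of _ "{..<q} \<times> {..<q}"]) (auto simp: ord_pairs_def)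

lemma inv_sign_cong: "(\<And>i. i < q \<Longrightarrow> l i = l' i) \<Longrightarrow> inv_sign q l = inv_sign q l'"
  unfolding inv_sign_def by (intro prod.cong) (auto simp: ord_pairs_def)

lemma inv_sign_nonzero: "inj_on l {..<q} \<Longrightarrow> inv_sign q l \<noteq> 0"
  unfolding inv_sign_def prod_zero_iff[OF finite_ord_pairs]
  by (auto simp: ord_pairs_def sgn_eq_0_iff dest: inj_onD)

lemma inv_sign_strict_mono: "strict_mono_on {..<q} l \<Longrightarrow> inv_sign q l = 1"
  unfolding inv_sign_def by (intro prod.neutral) (auto simp: ord_pairs_def strict_mono_on_def)

text \<open>Read each pair \<open>p i\<close>, \<open>p j\<close> in increasing order. This permutes
  the factors of \<open>inv_sign q l\<close>, and every pair that \<open>p\<close> inverts costs one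
  sign, which is the factor contributed by \<open>inv_sign q p\<close>.\<close>

lemma inv_sign_comp:
  assumes p: "p permutes {..<q}"
  shows "inv_sign q (l \<circ> p) = inv_sign q l * inv_sign q p"
proof -
  \<comment> \<open>The action of \<open>p\<close> on two-element sets, each written as an
    increasing pair.\<close>
  define h where "h = (\<lambda>(i, j). (min (p i) (p j), max (p i) (p j)))"
  have lt: "p i < q \<longleftrightarrow> i < q" for i using permutes_in_image[OF p] by simp
  have neq: "p i = p j \<longleftrightarrow> i = j" for i j using permutes_inj[OF p] by (simp add: inj_eq)
  have "h ` ord_pairs q \<subseteq> ord_pairs q"
    by (auto simp: h_def ord_pairs_def lt neq min_less_iff_disj less_max_iff_disj)
      (metis neq nat_neq_iff order.irrefl)+
  moreover have "inj_on h (ord_pairs q)"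
    by (rule inj_onI) (auto simp: h_def ord_pairs_def min_def max_def neq split: if_splits)
  ultimately have bij: "bij_betw h (ord_pairs q) (ord_pairs q)"
    by (simp add: bij_betw_def endo_inj_surj)
  have "inv_sign q (l \<circ> p) = (\<Prod>x\<in>ord_pairs q.
      (case h x of (i, j) \<Rightarrow> sgn (int (l j) - int (l i))) * (case x of (i, j) \<Rightarrow> sgn (int (p j) - int (p i))))"
    unfolding inv_sign_def
  proof (intro prod.cong refl)
    fix x assume "x \<in> ord_pairs q"
    then obtain i j where x: "x = (i, j)" "i < j" by (auto simp: ord_pairs_def)
    have "sgn (int (l (p j)) - int (l (p i))) = - sgn (int (l (p i)) - int (l (p j)))"
      by (simp add: sgn_if)
    then show "(case x of (i, j) \<Rightarrow> sgn (int ((l \<circ> p) j) - int ((l \<circ> p) i))) =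
        (case h x of (i, j) \<Rightarrow> sgn (int (l j) - int (l i))) * (case x of (i, j) \<Rightarrow> sgn (int (p j) - int (p i)))"
      using x neq[of i j] by (cases "p i < p j") (auto simp: h_def)
  qed
  also have "\<dots> = (\<Prod>x\<in>ord_pairs q. case h x of (i, j) \<Rightarrow> sgn (int (l j) - int (l i))) * inv_sign q p"
    by (simp add: prod.distrib inv_sign_def)
  also have "(\<Prod>x\<in>ord_pairs q. case h x of (i, j) \<Rightarrow> sgn (int (l j) - int (l i))) = inv_sign q l"
    unfolding inv_sign_def by (rule prod.reindex_bij_betw[OF bij])
  finally show ?thesis .
qed

text \<open>The transposition of 0 and 1 inverts one pair only, and every transposition is conjugate
  to it by some \<open>r\<close>, whose own sign cancels.\<close>

lemma inv_sign_transpose: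
  assumes "a \<noteq> b" "a < q" "b < q"
  shows "inv_sign q (transpose a b) = -1"
proof -
  have q: "1 < q" using assms by linarith
  let ?t = "transpose 0 1 :: nat \<Rightarrow> nat"
  have "inv_sign q ?t = sgn (int (?t 1) - int (?t 0)) *
      (\<Prod>(i, j)\<in>ord_pairs q - {(0, 1)}. sgn (int (?t j) - int (?t i)))"
    unfolding inv_sign_def using q by (subst prod.remove[OF finite_ord_pairs, of "(0, 1)"]) (auto simp: ord_pairs_def)
  moreover have "(\<Prod>(i, j)\<in>ord_pairs q - {(0, 1)}. sgn (int (?t j) - int (?t i))) = 1"
  proof (intro prod.neutral ballI)
    fix x assume "x \<in> ord_pairs q - {(0, 1)}"
    then obtain i j where x: "x = (i, j)" "i < j" "\<not> (i = 0 \<and> j = 1)" by (auto simp: ord_pairs_def)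
    then have "?t i < ?t j"
      by (cases "i = 0"; cases "i = 1"; cases "j = 1") (auto simp: transpose_def)
    then show "(case x of (i, j) \<Rightarrow> sgn (int (?t j) - int (?t i))) = 1"
      using x(1) by simp
  qed
  ultimately have t: "inv_sign q ?t = -1" by simp
  \<comment> \<open>\<open>b'\<close> is the preimage of \<open>b\<close> under the first swap, so
    that \<open>r\<close> sends 0 to \<open>a\<close> and 1 to \<open>b\<close>.\<close>
  define b' where "b' = transpose 0 a b"
  define r where "r = transpose 0 a \<circ> transpose 1 b'"
  have b': "b' \<noteq> 0" "b' < q" using assms by (auto simp: b'_def transpose_def)
  have r: "r permutes {..<q}"
    unfolding r_def using assms q b' by (intro permutes_compose permutes_swap_id) auto
  have "r 0 = a" "r 1 = b" using b' by (auto simp: r_def b'_def)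
  have "transpose a b \<circ> r = r \<circ> ?t"
  proof
    fix x
    show "(transpose a b \<circ> r) x = (r \<circ> ?t) x"
      using permutes_inj[OF r] \<open>r 0 = a\<close> \<open>r 1 = b\<close>
      by (cases "x = 0"; cases "x = 1") (auto simp: transpose_def inj_eq)
  qed
  moreover have "inv_sign q (r \<circ> ?t) = inv_sign q r * inv_sign q ?t"
    by (intro inv_sign_comp permutes_swap_id) (use q in auto)
  ultimately have "inv_sign q (transpose a b) * inv_sign q r = inv_sign q r * inv_sign q ?t"
    using inv_sign_comp[OF r, of "transpose a b"] by (simp only:)
  moreover have "inv_sign q r \<noteq> 0"
    by (intro inv_sign_nonzero inj_on_subset[OF permutes_inj[OF r]]) simp
  ultimately show ?thesis using t by simp
qed

text \<open>Both sides agree at the identity and change sign under composition with a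
  transposition.\<close>

lemma inv_sign_permutes:
  assumes "p permutes {..<q}"
  shows "inv_sign q p = sign p"
  using assms finite_lessThan
proof (induction rule: permutes_induct)
  case id
  then show ?case using inv_sign_strict_mono[of q id] by (simp add: strict_mono_on_def id_def)
next
  case (swap a b p)
  have "permutation p" using swap(4) finite_lessThan permutation_permutes by blast
  then have "sign (transpose a b \<circ> p) = - sign p"
    using swap(3) by (subst sign_compose) (simp_all add: permutation_swap_id sign_swap_id)
  moreover have "inv_sign q (transpose a b \<circ> p) = - sign p"
    using swap inv_sign_transpose[of a b q] by (subst inv_sign_comp) simp_all
  ultimately show ?case by (simp only:)
qed

text \<open>The increasing enumeration of the numbers other than \<open>i\<close>, the counterpart
  on indices of \<open>insert_coord i\<close>.\<close>

definition skip :: "nat \<Rightarrow> nat \<Rightarrow> nat" where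
  "skip i j = (if j < i then j else Suc j)"

lemma bij_betw_skip: "i < Suc q \<Longrightarrow> bij_betw (skip i) {..<q} ({..<Suc q} - {i})"
  by (rule bij_betwI[of _ _ _ "\<lambda>j. if j < i then j else j - 1"]) (auto simp: skip_def split: if_splits)

text \<open>The pairs avoiding \<open>i\<close> make up
  \<open>inv_sign q (l \<circ> skip i)\<close>. Reversing the \<open>i\<close> pairs that end in
  \<open>i\<close> costs \<open>(-1) ^ i\<close>; what remains compares \<open>l i\<close> with all
  other values and counts the smaller ones. This links the position \<open>i\<close> in the singular
  boundary to the rank of \<open>l i\<close> in the elementary one.\<close>

lemma inv_sign_delete:
  assumes l: "inj_on l {..<Suc q}" and i: "i < Suc q"
  shows "inv_sign (Suc q) l =
    inv_sign q (l \<circ> skip i) * (-1) ^ i * (-1) ^ card {k \<in> l ` {..<Suc q}. k < l i}"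
proof -
  let ?s = "\<lambda>(a, b). sgn (int (l b) - int (l a))"
  define S where "S = {..<Suc q} - {i}"
  let ?A = "map_prod (skip i) (skip i) ` ord_pairs q"
  have inj: "inj_on (map_prod (skip i) (skip i)) (ord_pairs q)"
    by (auto simp: inj_on_def skip_def split: if_splits)
  have eq: "ord_pairs (Suc q) = ?A \<union> ((\<lambda>a. (a, i)) ` {..<i} \<union> Pair i ` {i<..<Suc q})"
  proof (intro Set.set_eqI iffI)
    fix x assume "x \<in> ord_pairs (Suc q)"
    then obtain a b where x: "x = (a, b)" "a < b" "b < Suc q" by (auto simp: ord_pairs_def)
    show "x \<in> ?A \<union> ((\<lambda>a. (a, i)) ` {..<i} \<union> Pair i ` {i<..<Suc q})"
    proof (cases "a = i \<or> b = i")
      case False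
      then have "x = map_prod (skip i) (skip i) (if a < i then a else a - 1, if b < i then b else b - 1)"
        using x by (auto simp: skip_def)
      moreover have "(if a < i then a else a - 1, if b < i then b else b - 1) \<in> ord_pairs q"
        using x False i by (auto simp: ord_pairs_def)
      ultimately show ?thesis by blast
    qed (use x in auto)
  qed (use i in \<open>auto simp: ord_pairs_def skip_def\<close>)
  have "inv_sign (Suc q) l = prod ?s ?A * (prod ?s ((\<lambda>a. (a, i)) ` {..<i}) * prod ?s (Pair i ` {i<..<Suc q}))"
    unfolding inv_sign_def eq
    by (subst prod.union_disjoint; (subst prod.union_disjoint)?) (auto simp: skip_def split: if_splits)
  also have "prod ?s ?A = inv_sign q (l \<circ> skip i)"
    unfolding inv_sign_def by (subst prod.reindex[OF inj]) (auto intro!: prod.cong)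
  also have "prod ?s ((\<lambda>a. (a, i)) ` {..<i}) = (\<Prod>a<i. (-1) * sgn (int (l a) - int (l i)))"
    by (subst prod.reindex) (auto simp: inj_on_def sgn_if intro!: prod.cong)
  also have "\<dots> = (-1) ^ i * (\<Prod>a<i. sgn (int (l a) - int (l i)))"
    by (subst prod.distrib) simp
  also have "prod ?s (Pair i ` {i<..<Suc q}) = (\<Prod>a\<in>{i<..<Suc q}. sgn (int (l a) - int (l i)))"
    by (subst prod.reindex) (auto simp: inj_on_def intro!: prod.cong)
  also have "(-1) ^ i * (\<Prod>a<i. sgn (int (l a) - int (l i))) * \<dots> =
      (-1) ^ i * (\<Prod>a\<in>S. sgn (int (l a) - int (l i)))"
  proof -
    have "S = {..<i} \<union> {i<..<Suc q}" using i by (auto simp: S_def)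
    then show ?thesis by (simp add: mult.assoc) (subst prod.union_disjoint, auto)
  qed
  also have "(\<Prod>a\<in>S. sgn (int (l a) - int (l i))) = (\<Prod>a\<in>S. if l a < l i then -1 else 1)"
    using i by (intro prod.cong) (auto simp: S_def sgn_if inj_on_eq_iff[OF l])
  also have "\<dots> = (-1) ^ card {a \<in> S. l a < l i}"
    by (subst prod.If_cases) (auto simp: S_def Int_def)
  also have "card {a \<in> S. l a < l i} = card (l ` {a \<in> S. l a < l i})"
    by (rule card_image[symmetric]) (rule inj_on_subset[OF l], auto simp: S_def)
  also have "l ` {a \<in> S. l a < l i} = {k \<in> l ` {..<Suc q}. k < l i}"
    by (auto simp: S_def)
  finally show ?thesis by (simp only: mult.assoc)
qed

subsection \<open>Injective singular cubes are affine\<close>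

text \<open>\<open>\<sigma> t = x + (\<Sum>j<q. s\<^sub>j t\<^sub>j e\<^bsub>l j\<^esub>)\<close>, written out in coordinates.\<close>

definition affine_cube ::
    "nat \<Rightarrow> nat \<Rightarrow> (int vec \<Rightarrow> int vec) \<Rightarrow> (nat \<Rightarrow> int) \<Rightarrow> (nat \<Rightarrow> nat) \<Rightarrow> (nat \<Rightarrow> int) \<Rightarrow> bool" where
  "affine_cube n q \<sigma> x l s \<longleftrightarrow> inj_on l {..<q} \<and> l ` {..<q} \<subseteq> {..<n} \<and> (\<forall>j<q. s j \<in> {1, -1}) \<and>
     (\<forall>t\<in>Icube q. \<sigma> t \<in> carrier_vec n \<and> (\<forall>j<q. \<sigma> t $ l j = x (l j) + s j * t $ j) \<and>
       (\<forall>k<n. k \<notin> l ` {..<q} \<longrightarrow> \<sigma> t $ k = x k))"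

lemma affine_cubeD:
  assumes "affine_cube n q \<sigma> x l s"
  shows "inj_on l {..<q}" "j < q \<Longrightarrow> l j < n" "j < q \<Longrightarrow> s j = 1 \<or> s j = -1"
    and "t \<in> Icube q \<Longrightarrow> \<sigma> t \<in> carrier_vec n"
    and "t \<in> Icube q \<Longrightarrow> j < q \<Longrightarrow> \<sigma> t $ l j = x (l j) + s j * t $ j"
    and "t \<in> Icube q \<Longrightarrow> k < n \<Longrightarrow> k \<notin> l ` {..<q} \<Longrightarrow> \<sigma> t $ k = x k"
  using assms by (auto simp: affine_cube_def)

definition unit_step :: "nat \<Rightarrow> int vec \<Rightarrow> int vec \<Rightarrow> nat \<Rightarrow> int \<Rightarrow> bool" where
  "unit_step n x y k e \<longleftrightarrow> x \<in> carrier_vec n \<and> y \<in> carrier_vec n \<and> k < n \<and> (e = 1 \<or> e = -1) \<and>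
     (\<forall>i<n. y $ i = x $ i + (if i = k then e else 0))"

lemma unit_step_ex:
  assumes "c1_adjacent x y" "x \<in> carrier_vec n"
  shows "\<exists>k e. unit_step n x y k e"
proof -
  have dx: "dim_vec x = n" using assms(2) by simp
  then obtain k where k: "k < n" "\<bar>x $ k - y $ k\<bar> = 1" "dim_vec y = n"
    and eq: "\<And>j. j < n \<Longrightarrow> j \<noteq> k \<Longrightarrow> x $ j = y $ j"
    using assms(1) unfolding c1_adjacent_def by metis
  have "y $ k - x $ k = 1 \<or> y $ k - x $ k = -1" using k(2) by linarith
  moreover have "y $ i = x $ i + (if i = k then y $ k - x $ k else 0)" if "i < n" for i
    using eq[OF that] by simp
  moreover have "y \<in> carrier_vec n" using k(3) by (rule carrier_vecI)
  ultimately have "unit_step n x y k (y $ k - x $ k)"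
    using k(1) assms(2) unfolding unit_step_def by blast
  then show ?thesis by blast
qed

lemma unit_step_unique:
  assumes "unit_step n x y k e" "unit_step n x z k e" shows "y = z"
  using assms by (intro eq_vecI) (auto simp: unit_step_def)

lemma unit_step_back:
  assumes "unit_step n x y k e" "unit_step n y z k (- e)" shows "x = z"
  using assms by (intro eq_vecI) (auto simp: unit_step_def)

text \<open>An injectively mapped 4-cycle has parallel opposite sides, which forces affinity.\<close>

lemma unit_step_square:
  assumes wx: "unit_step n w x k e" and wy: "unit_step n w y k' e'"
    and xz: "unit_step n x z a c" and yz: "unit_step n y z a' c'"
    and ne: "x \<noteq> y" "w \<noteq> z"
  shows "unit_step n x z k' e'"
proof -
  \<comment> \<open>The two steps out of \<open>w\<close> differ, and the path through
    \<open>x\<close> does not return to \<open>w\<close>.\<close>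
  have n1: "\<not> (k = k' \<and> e = e')" using unit_step_unique wx wy ne(1) by blast
  have n2: "\<not> (a = k \<and> c = - e)" using unit_step_back wx xz ne(2) by blast
  have lt: "k < n" "k' < n" "a < n" "a' < n"
    and e: "e = 1 \<or> e = -1" "e' = 1 \<or> e' = -1" "c = 1 \<or> c = -1" "c' = 1 \<or> c' = -1"
    using assms by (auto simp: unit_step_def)
  \<comment> \<open>Both paths from \<open>w\<close> to \<open>z\<close> have the same displacement,
    compared here coordinate by coordinate.\<close>
  have eq: "(if i = k then e else 0) + (if i = a then c else 0) =
      (if i = k' then e' else 0) + (if i = a' then c' else 0)" if i: "i < n" for i
  proof -
    have "x $ i = w $ i + (if i = k then e else 0)" "y $ i = w $ i + (if i = k' then e' else 0)"
      "z $ i = x $ i + (if i = a then c else 0)" "z $ i = y $ i + (if i = a' then c' else 0)"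
      using assms(1-4) i by (auto simp: unit_step_def)
    then show ?thesis by linarith
  qed
  have "a = k' \<and> c = e'"
  proof (cases "k = k'")
    case True
    \<comment> \<open>Opposite steps along one axis could only meet again at \<open>w\<close>, so
      this case contradicts \<open>n2\<close>.\<close>
    then have "e' = - e" using n1 e by auto
    then show ?thesis using eq[OF lt(1)] True n2 e by (auto split: if_splits)
  next
    case False
    have "a \<noteq> k" using eq[OF lt(1)] False n2 e by (auto split: if_splits)
    then have "a' = k" using eq[OF lt(1)] False e by (auto split: if_splits)
    then show ?thesis using eq[OF lt(2)] False e by (auto split: if_splits)
  qed
  then show ?thesis using xz by simp
qed

text \<open>Indexing the points of the cube by subsets of \<open>{..<q}\<close> makes induction on
  finite sets available for moving along edges.\<close>

definition vertex :: "nat \<Rightarrow> nat set \<Rightarrow> int vec" where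
  "vertex q S = vec q (\<lambda>i. if i \<in> S then 1 else 0)"

lemma vertex_Icube [simp]: "vertex q S \<in> Icube q"
  by (simp add: vertex_def Icube_def)

lemma vertex_index [simp]: "i < q \<Longrightarrow> vertex q S $ i = (if i \<in> S then 1 else 0)"
  by (simp add: vertex_def)

lemma Icube_vertex: "t \<in> Icube q \<Longrightarrow> t = vertex q {j. j < q \<and> t $ j = 1}"
  by (intro eq_vecI) (auto simp: vertex_def Icube_def)

lemma vertex_adjacent:
  assumes "j < q" "j \<notin> S"
  shows "c1_adjacent (vertex q S) (vertex q (insert j S))"
  using assms by (auto simp: c1_adjacent_def vertex_def intro!: exI[of _ j])

text \<open>The edges at the origin define \<open>l\<close> and \<open>s\<close>. The square lemma
  carries direction and sign to all parallel edges, and adding up the steps along a path from the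
  origin gives the affine formula.\<close>

lemma injective_cube_affine:
  assumes \<sigma>: "\<sigma> \<in> singular_cubes X q" and X: "X \<subseteq> carrier_vec n" and inj: "inj_on \<sigma> (Icube q)"
  obtains x l s where "affine_cube n q \<sigma> x l s"
proof -
  define f where "f = (\<lambda>S. \<sigma> (vertex q S))"
  have car: "\<sigma> t \<in> carrier_vec n" if "t \<in> Icube q" for t
    using \<sigma> X that by (auto simp: singular_cubes_def c1_continuous_def)
  have f_eq: "f S = f T \<longleftrightarrow> S = T" if "S \<subseteq> {..<q}" "T \<subseteq> {..<q}" for S T
  proof
    assume "f S = f T"
    then have v: "vertex q S = vertex q T"
      using inj_onD[OF inj, of "vertex q S" "vertex q T"] by (simp add: f_def)
    have "i \<in> S \<longleftrightarrow> i \<in> T" if "i < q" for i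
      using arg_cong[OF v, of "\<lambda>t. t $ i"] that by (simp add: vertex_def split: if_splits)
    then show "S = T" using that by blast
  qed simp
  have ex: "\<exists>k e. unit_step n (f S) (f (insert j S)) k e" if "S \<subseteq> {..<q}" "j < q" "j \<notin> S" for S j
  proof (rule unit_step_ex)
    have "f S \<noteq> f (insert j S)" using f_eq[of S "insert j S"] that by blast
    then show "c1_adjacent (f S) (f (insert j S))"
      using \<sigma> vertex_adjacent[OF that(2,3)] vertex_Icube[of q S] vertex_Icube[of q "insert j S"]
      unfolding f_def singular_cubes_def c1_continuous_def by blast
  qed (simp add: f_def car)
  obtain l s where base: "\<And>j. j < q \<Longrightarrow> unit_step n (f {}) (f {j}) (l j) (s j)"
    using ex[of "{}"] by simp metis
  have step: "\<forall>j<q. j \<notin> S \<longrightarrow> unit_step n (f S) (f (insert j S)) (l j) (s j)" if "S \<subseteq> {..<q}" for S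
    using finite_subset[OF that finite_lessThan] that
  proof (induction S rule: finite_induct)
    case empty
    then show ?case using base by simp
  next
    case (insert i S)
    show ?case
    proof (intro allI impI)
      fix j assume j: "j < q" "j \<notin> insert i S"
      have i: "i < q" "i \<notin> S" "S \<subseteq> {..<q}" using insert by auto
      have "unit_step n (f S) (f (insert i S)) (l i) (s i)" "unit_step n (f S) (f (insert j S)) (l j) (s j)"
        using insert.IH i j by auto
      moreover obtain a c where "unit_step n (f (insert i S)) (f (insert j (insert i S))) a c"
        using ex[of "insert i S" j] insert.prems j by blast
      moreover obtain a' c' where "unit_step n (f (insert j S)) (f (insert j (insert i S))) a' c'"
        using ex[of "insert j S" i] i j by (auto simp: insert_commute)
      moreover have "f (insert i S) \<noteq> f (insert j S)" "f S \<noteq> f (insert j (insert i S))"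
        using f_eq[of "insert i S" "insert j S"] f_eq[of S "insert j (insert i S)"] i j by auto
      ultimately show "unit_step n (f (insert i S)) (f (insert j (insert i S))) (l j) (s j)"
        by (rule unit_step_square)
    qed
  qed
  have s: "s j = 1 \<or> s j = -1" and l: "l j < n" if "j < q" for j
    using base[OF that] by (auto simp: unit_step_def)
  \<comment> \<open>Two edges at the origin along the same axis either coincide, giving
    \<open>f {i} = f {j}\<close>, or are opposite, giving \<open>f {} = f {j, i}\<close>.\<close>
  have inj_l: "inj_on l {..<q}"
  proof (rule inj_onI, rule ccontr)
    fix i j assume ij: "i \<in> {..<q}" "j \<in> {..<q}" "l i = l j" "i \<noteq> j"
    have "f {i} \<noteq> f {j}" "f {} \<noteq> f {j, i}" using ij f_eq[of "{i}" "{j}"] f_eq[of "{}" "{j, i}"] by auto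
    moreover have "unit_step n (f {}) (f {i}) (l i) (s i)" "unit_step n (f {}) (f {j}) (l i) (s j)"
      "unit_step n (f {i}) (f {j, i}) (l i) (s j)"
      using base[of i] base[of j] step[of "{i}"] ij by auto
    ultimately show False
      using unit_step_unique unit_step_back s[of i] s[of j] ij by (metis lessThan_iff minus_minus)
  qed
  have val: "(\<forall>j<q. f S $ l j = f {} $ l j + s j * (if j \<in> S then 1 else 0)) \<and>
      (\<forall>k<n. k \<notin> l ` {..<q} \<longrightarrow> f S $ k = f {} $ k)" if "S \<subseteq> {..<q}" for S
    using finite_subset[OF that finite_lessThan] that
  proof (induction S rule: finite_induct)
    case (insert i S)
    then have i: "i < q" and IH: "\<And>j. j < q \<Longrightarrow> f S $ l j = f {} $ l j + s j * (if j \<in> S then 1 else 0)"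
      "\<And>k. k < n \<Longrightarrow> k \<notin> l ` {..<q} \<Longrightarrow> f S $ k = f {} $ k" by auto
    have "unit_step n (f S) (f (insert i S)) (l i) (s i)" using step[of S] insert by auto
    then have st: "\<And>k. k < n \<Longrightarrow> f (insert i S) $ k = f S $ k + (if k = l i then s i else 0)"
      by (auto simp: unit_step_def)
    have "l j = l i \<longleftrightarrow> j = i" if "j < q" for j
      using inj_on_eq_iff[OF inj_l] that i by simp
    then show ?case using st IH l i insert(2) by auto
  qed simp
  have "affine_cube n q \<sigma> (\<lambda>k. f {} $ k) l s"
    unfolding affine_cube_def
  proof (intro conjI ballI)
    fix t assume t: "t \<in> Icube q"
    define S where "S = {j. j < q \<and> t $ j = 1}"
    have "f S = \<sigma> t" using Icube_vertex[OF t] by (simp add: f_def S_def)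
    moreover have "t $ j = (if j \<in> S then 1 else 0)" if "j < q" for j
      using t that by (auto simp: S_def Icube_def)
    moreover have "S \<subseteq> {..<q}" by (auto simp: S_def)
    ultimately show "\<forall>j<q. \<sigma> t $ l j = f {} $ l j + s j * t $ j"
      "\<forall>k<n. k \<notin> l ` {..<q} \<longrightarrow> \<sigma> t $ k = f {} $ k" using val[of S] by auto
  qed (use inj_l l s car in auto)
  then show thesis by (rule that)
qed

lemma affine_cube_inj:
  assumes "affine_cube n q \<sigma> x l s"
  shows "inj_on \<sigma> (Icube q)"
proof (rule inj_onI)
  fix t u assume tu: "t \<in> Icube q" "u \<in> Icube q" "\<sigma> t = \<sigma> u"
  have "t $ j = u $ j" if "j < q" for j
    using affine_cubeD(3)[OF assms that] affine_cubeD(5)[OF assms tu(1) that]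
      affine_cubeD(5)[OF assms tu(2) that] tu(3) by auto
  then show "t = u" using tu by (intro eq_vecI) (auto simp: Icube_def)
qed

text \<open>The least corner of the image of an affine cube.\<close>

definition affine_base :: "nat \<Rightarrow> (nat \<Rightarrow> int) \<Rightarrow> (nat \<Rightarrow> nat) \<Rightarrow> (nat \<Rightarrow> int) \<Rightarrow> nat \<Rightarrow> int" where
  "affine_base q x l s k = x k - (if \<exists>j<q. l j = k \<and> s j = -1 then 1 else 0)"

lemma affine_base_in:
  "inj_on l {..<q} \<Longrightarrow> j < q \<Longrightarrow> affine_base q x l s (l j) = x (l j) - (if s j = -1 then 1 else 0)"
  by (auto simp: affine_base_def dest: inj_onD)

lemma affine_base_out: "k \<notin> l ` {..<q} \<Longrightarrow> affine_base q x l s k = x k"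
  by (auto simp: affine_base_def)

lemma affine_cube_image:
  assumes "affine_cube n q \<sigma> x l s"
  shows "\<sigma> ` Icube q = ecube n (affine_base q x l s) (l ` {..<q})"
proof (intro Set.set_eqI iffI)
  note A = affine_cubeD[OF assms]
  note B = affine_base_in[OF A(1), of _ x s]
  {
    fix y assume "y \<in> \<sigma> ` Icube q"
    then obtain t where t: "t \<in> Icube q" "y = \<sigma> t" by blast
    have "y $ k = affine_base q x l s k \<or> k \<in> l ` {..<q} \<and> y $ k = affine_base q x l s k + 1"
      if k: "k < n" for k
    proof (cases "k \<in> l ` {..<q}")
      case True
      then obtain j where j: "j < q" "k = l j" by blast
      have "t $ j = 0 \<or> t $ j = 1" using t j by (auto simp: Icube_def)
      then show ?thesis using A(3)[OF j(1)] A(5)[OF t(1) j(1)] B[OF j(1)] j t(2) by auto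
    next
      case False
      then show ?thesis using A(6)[OF t(1) k] t(2) affine_base_out by simp
    qed
    then show "y \<in> ecube n (affine_base q x l s) (l ` {..<q})"
      using A(4) t by (auto simp: ecube_iff)
  next
    fix y assume y: "y \<in> ecube n (affine_base q x l s) (l ` {..<q})"
    \<comment> \<open>The affine formula solved for \<open>t\<close>, each \<open>s j\<close> being
      its own inverse.\<close>
    define t where "t = vec q (\<lambda>j. s j * (y $ l j - x (l j)))"
    have yl: "y $ l j = x (l j) + s j * t $ j \<and> (t $ j = 0 \<or> t $ j = 1)" if j: "j < q" for j
    proof -
      have "y $ l j = affine_base q x l s (l j) \<or> y $ l j = affine_base q x l s (l j) + 1"
        using y A(2)[OF j] by (auto simp: ecube_iff)
      then show ?thesis using A(3)[OF j] B[OF j] j by (auto simp: t_def)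
    qed
    then have t: "t \<in> Icube q" by (auto simp: Icube_def t_def)
    have "\<sigma> t = y"
    proof (rule eq_vecI)
      show "dim_vec (\<sigma> t) = dim_vec y" using A(4)[OF t] y by (auto simp: ecube_iff)
      fix k assume "k < dim_vec y"
      then have k: "k < n" using y by (auto simp: ecube_iff)
      show "\<sigma> t $ k = y $ k"
      proof (cases "k \<in> l ` {..<q}")
        case True
        then show ?thesis using A(5)[OF t] yl by auto
      next
        case False
        then have "y $ k = affine_base q x l s k" using y k by (auto simp: ecube_iff)
        then show ?thesis using A(6)[OF t k False] affine_base_out[OF False] by simp
      qed
    qed
    then show "y \<in> \<sigma> ` Icube q" using t by blast
  }
qed

text \<open>The displacement from the origin to its neighbour in direction \<open>j\<close> shows
  both \<open>l j\<close> and \<open>s j\<close>. The orientation therefore depends on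
  \<open>\<sigma>\<close> alone.\<close>

lemma affine_cube_unique:
  assumes "affine_cube n q \<sigma> x l s" "affine_cube n q \<sigma> x' l' s'" "j < q"
  shows "l j = l' j" "s j = s' j"
proof -
  have diff: "\<sigma> (vertex q {j}) $ k = \<sigma> (vertex q {}) $ k + (if k = l j then s j else 0)"
    if "affine_cube n q \<sigma> x l s" "k < n" for k x l s
  proof (cases "k \<in> l ` {..<q}")
    case True
    then obtain i where "i < q" "k = l i" by blast
    then show ?thesis
      using affine_cubeD(5)[OF that(1) vertex_Icube[of q "{j}"], of i]
        affine_cubeD(5)[OF that(1) vertex_Icube[of q "{}"], of i]
        inj_on_eq_iff[OF affine_cubeD(1)[OF that(1)], of i j] assms(3) by auto
  next
    case False
    then show ?thesis
      using affine_cubeD(6)[OF that(1) vertex_Icube that(2)] assms(3) by auto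
  qed
  have "(if l j = l' j then s' j else 0) = s j"
    using diff[OF assms(1), of "l j"] diff[OF assms(2), of "l j"] affine_cubeD(2)[OF assms(1,3)] by simp
  then show "l j = l' j" "s j = s' j"
    using affine_cubeD(3)[OF assms(1,3)] by (auto split: if_splits)
qed


subsection \<open>Orientation of affine cubes\<close>

lemma embedding_mult_vec:
  assumes k: "strict_mono_on {..<q} k" "k ` {..<q} \<subseteq> {..<n}" and v: "dim_vec v = q"
    and M: "M = mat n q (\<lambda>(i, j). if i = k j then 1 else (0::int))"
  shows "p < q \<Longrightarrow> (M *\<^sub>v v) $ k p = v $ p"
    and "r < n \<Longrightarrow> r \<notin> k ` {..<q} \<Longrightarrow> (M *\<^sub>v v) $ r = 0"
proof -
  have Mv: "(M *\<^sub>v v) $ r = (\<Sum>j<q. if r = k j then v $ j else 0)" if "r < n" for r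
    using that v by (auto simp: M scalar_prod_def atLeast0LessThan intro!: sum.cong)
  have inj: "inj_on k {..<q}" using k(1) by (rule strict_mono_on_imp_inj_on)
  show "(M *\<^sub>v v) $ k p = v $ p" if p: "p < q"
  proof -
    have "(\<Sum>j<q. if k p = k j then v $ j else 0) = (\<Sum>j<q. if p = j then v $ j else 0)"
      using inj_on_eq_iff[OF inj] p by (intro sum.cong) auto
    then show ?thesis using Mv[of "k p"] k(2) p by auto
  qed
  show "(M *\<^sub>v v) $ r = 0" if "r < n" "r \<notin> k ` {..<q}"
    using Mv[OF that(1)] that(2) by (auto intro!: sum.neutral)
qed

text \<open>Adding \<open>z $ i\<close> mod 2 to a bit amounts to the affine map with slope
  \<open>1 - 2 * z $ i\<close>, so \<open>z\<close> yields the signs. Coordinate \<open>j\<close> of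
  \<open>t\<close> lands in row \<open>k (p' j)\<close> with \<open>p'\<close> the inverse of
  \<open>p\<close>; since \<open>k\<close> is increasing, the inversion parity of
  \<open>k \<circ> p'\<close> is the sign of \<open>p'\<close>, which equals that of
  \<open>p\<close>.\<close>

lemma standard_form_affine:
  assumes sf: "standard_form n X q \<sigma> M z p x" and X: "X \<subseteq> carrier_vec n"
  obtains x' l s where "affine_cube n q \<sigma> x' l s"
    and "(-1) ^ card {i. i < q \<and> z $ i \<noteq> 0} * sign p = (\<Prod>j<q. s j) * inv_sign q l"
proof -
  obtain k where k: "strict_mono_on {..<q} k" "k ` {..<q} \<subseteq> {..<n}"
    and M: "M = mat n q (\<lambda>(i, j). if i = k j then 1 else 0)"
    using sf by (auto simp: standard_form_def embedding_matrix_def)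
  have z: "z \<in> Icube q" and p: "p permutes {..<q}" and x: "x \<in> carrier_vec n"
    and \<sigma>: "\<And>t. t \<in> Icube q \<Longrightarrow> \<sigma> t = M *\<^sub>v add_mod2 z (perm_vec p t) + x"
    using sf X by (auto simp: standard_form_def)
  have p': "Hilbert_Choice.inv p permutes {..<q}" by (rule permutes_inv[OF p])
  define p' where "p' = Hilbert_Choice.inv p"
  have p'_lt: "p' j < q \<longleftrightarrow> j < q" and p_lt: "p j < q \<longleftrightarrow> j < q" and pp': "p (p' j) = j" for j
    using permutes_in_image[OF p'] permutes_in_image[OF p] permutes_inverses(1)[OF p] by (simp_all add: p'_def)
  define l where "l = k \<circ> p'"
  define s where "s = (\<lambda>j. 1 - 2 * z $ p' j)"
  have z01: "z $ i = 0 \<or> z $ i = 1" if "i < q" for i using z that by (auto simp: Icube_def)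
  have inj: "inj_on k {..<q}" using k(1) by (rule strict_mono_on_imp_inj_on)
  have l_im: "l ` {..<q} = k ` {..<q}"
    using permutes_image[OF p'] by (metis image_comp l_def p'_def)
  have "affine_cube n q \<sigma> (\<lambda>i. \<sigma> (vertex q {}) $ i) l s"
    unfolding affine_cube_def
  proof (intro conjI ballI allI impI)
    show "inj_on l {..<q}"
      using p' inj unfolding l_def p'_def
      by (intro comp_inj_on) (auto simp: permutes_image intro: inj_on_subset permutes_inj)
    show "l ` {..<q} \<subseteq> {..<n}" using l_im k by simp
    show "s j \<in> {1, -1}" if "j < q" for j
      using z01[of "p' j"] that by (auto simp: s_def p'_lt)
  next
    fix t assume t: "t \<in> Icube q"
    show "\<sigma> t \<in> carrier_vec n" using \<sigma>[OF t] x by (auto intro!: carrier_vecI)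
    have *: "dim_vec (add_mod2 z (perm_vec p u)) = q" if "u \<in> Icube q" for u
      using that by (simp add: add_mod2_def perm_vec_def Icube_def)
    note mult = embedding_mult_vec[OF k *, OF _ M]
    have val: "\<sigma> u $ l j = (z $ p' j + u $ j) mod 2 + x $ l j" if u: "u \<in> Icube q" and j: "j < q" for u j
    proof -
      have "l j < n" using k(2) j p'_lt[of j] by (auto simp: l_def image_subset_iff)
      then have "\<sigma> u $ l j = (M *\<^sub>v add_mod2 z (perm_vec p u)) $ l j + x $ l j"
        using \<sigma>[OF u] x by simp
      also have "(M *\<^sub>v add_mod2 z (perm_vec p u)) $ l j = add_mod2 z (perm_vec p u) $ p' j"
        using mult(1)[OF u, of "p' j"] j by (simp add: l_def p'_lt)
      also have "\<dots> = (z $ p' j + u $ j) mod 2"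
      proof -
        have "dim_vec u = q" using u by (simp add: Icube_def)
        then show ?thesis using j p'_lt[of j] by (simp add: add_mod2_def perm_vec_def pp')
      qed
      finally show ?thesis .
    qed
    show "\<sigma> t $ l j = \<sigma> (vertex q {}) $ l j + s j * t $ j" if j: "j < q" for j
    proof -
      have "t $ j = 0 \<or> t $ j = 1" using t j by (auto simp: Icube_def)
      then show ?thesis
        using val[OF t j] val[OF vertex_Icube j] z01[of "p' j"] j p'_lt
        by (auto simp: s_def)
    qed
    show "\<sigma> t $ r = \<sigma> (vertex q {}) $ r" if r: "r < n" "r \<notin> l ` {..<q}" for r
      using \<sigma>[OF t] \<sigma>[OF vertex_Icube] mult(2)[OF t r(1)] mult(2)[OF vertex_Icube r(1)] r l_im x
      by simp
  qed
  moreover have "(\<Prod>j<q. s j) = (\<Prod>i<q. 1 - 2 * z $ i)"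
    unfolding s_def using prod.permute[OF p', of "\<lambda>i. 1 - 2 * z $ i"] by (simp add: o_def p'_def)
  moreover have "(\<Prod>i<q. 1 - 2 * z $ i) = (\<Prod>i<q. if z $ i \<noteq> 0 then -1 else 1)"
    using z01 by (intro prod.cong) auto
  moreover have "(\<Prod>i<q. if z $ i \<noteq> 0 then -1 else 1 :: int) = (-1) ^ card {i. i < q \<and> z $ i \<noteq> 0}"
    by (subst prod.If_cases) (auto simp: Int_def)
  moreover have "inv_sign q l = sign p"
  proof -
    have "permutation p" using p finite_lessThan permutation_permutes by blast
    then show ?thesis
      unfolding l_def p'_def
      using inv_sign_comp[OF p', of k] inv_sign_strict_mono[OF k(1)] inv_sign_permutes[OF p']
      by (simp only: sign_inverse mult_1_left)
  qed
  ultimately show thesis using that by metis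
qed

text \<open>Supplies the witness for the description in \<open>orientation\<close>: sort the
  directions by \<open>k\<close>, let \<open>p\<close> record the sorting, let \<open>z\<close> mark
  the reversed directions, and translate by the least corner, which lies in \<open>X\<close> as a
  point of the image.\<close>

lemma affine_standard_form:
  assumes A: "affine_cube n q \<sigma> x l s" and X: "\<sigma> ` Icube q \<subseteq> X"
  shows "\<exists>M z p y. standard_form n X q \<sigma> M z p y"
proof -
  note A' = affine_cubeD[OF A]
  define K where "K = l ` {..<q}"
  have K: "finite K" "card K = q" "K \<subseteq> {..<n}"
    using A' by (auto simp: K_def card_image)
  define k where "k = (!) (sorted_list_of_set K)"
  have bij: "bij_betw k {..<q} K"
    unfolding k_def using bij_betw_nth[of "sorted_list_of_set K" "{..<q}" K] K by simp
  have mono: "strict_mono_on {..<q} k"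
  proof (rule strict_mono_onI)
    fix i j assume "i \<in> {..<q}" "j \<in> {..<q}" "i < j"
    then show "k i < k j"
      unfolding k_def using sorted_wrt_nth_less[OF strict_sorted_list_of_set[of K], of i j] K(1,2) by simp
  qed
  \<comment> \<open>The identity beyond \<open>q\<close> is what \<open>permutes\<close>
    demands.\<close>
  define p where "p = (\<lambda>i. if i < q then inv_into {..<q} l (k i) else i)"
  have bl: "bij_betw l {..<q} K" using A'(1) by (simp add: bij_betw_def K_def)
  have "bij_betw (inv_into {..<q} l \<circ> k) {..<q} {..<q}"
    by (rule bij_betw_trans[OF bij bij_betw_inv_into[OF bl]])
  then have "bij_betw p {..<q} {..<q}"
    by (rule bij_betw_cong[THEN iffD1, rotated]) (simp add: p_def)
  then have p: "p permutes {..<q}" by (rule bij_imp_permutes) (simp add: p_def)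
  have p_lt: "p i < q" if "i < q" for i using permutes_in_image[OF p, of i] that by simp
  have lp: "l (p i) = k i" if i: "i < q" for i
    using bij_betwE[OF bij] i by (auto simp: p_def K_def intro!: f_inv_into_f)
  define z :: "int vec" where "z = vec q (\<lambda>i. if s (p i) = -1 then 1 else 0)"
  define y where "y = vec n (affine_base q x l s)"
  define M :: "int mat" where "M = mat n q (\<lambda>(i, j). if i = k j then 1 else 0)"
  have kn: "k ` {..<q} \<subseteq> {..<n}" using bij K(3) by (auto simp: bij_betw_def)
  have "\<sigma> t = M *\<^sub>v add_mod2 z (perm_vec p t) + y" if t: "t \<in> Icube q" for t
  proof (rule eq_vecI)
    show "dim_vec (\<sigma> t) = dim_vec (M *\<^sub>v add_mod2 z (perm_vec p t) + y)"
      using A'(4)[OF t] by (simp add: y_def)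
    fix r assume "r < dim_vec (M *\<^sub>v add_mod2 z (perm_vec p t) + y)"
    then have r: "r < n" by (simp add: y_def)
    have dt: "dim_vec t = q" using t by (simp add: Icube_def)
    have d: "dim_vec (add_mod2 z (perm_vec p t)) = q"
      by (simp add: add_mod2_def perm_vec_def dt)
    have rhs: "(M *\<^sub>v add_mod2 z (perm_vec p t) + y) $ r =
        (M *\<^sub>v add_mod2 z (perm_vec p t)) $ r + affine_base q x l s r"
      using r by (simp add: y_def)
    show "\<sigma> t $ r = (M *\<^sub>v add_mod2 z (perm_vec p t) + y) $ r"
    proof (cases "r \<in> K")
      case True
      then obtain i where i: "i < q" "r = k i" using bij by (auto simp: bij_betw_def)
      have "(M *\<^sub>v add_mod2 z (perm_vec p t)) $ r = (z $ i + t $ p i) mod 2"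
        using embedding_mult_vec(1)[OF mono kn d M_def i(1)] i dt
        by (simp add: add_mod2_def perm_vec_def)
      moreover have "t $ p i = 0 \<or> t $ p i = 1" using t p_lt[OF i(1)] by (auto simp: Icube_def)
      ultimately show ?thesis
        using A'(5)[OF t p_lt[OF i(1)]] A'(3)[OF p_lt[OF i(1)]] affine_base_in[OF A'(1) p_lt[OF i(1)], of x s]
          lp[OF i(1)] i rhs by (auto simp: z_def)
    next
      case False
      then have "r \<notin> k ` {..<q}" using bij by (auto simp: bij_betw_def)
      then show ?thesis
        using embedding_mult_vec(2)[OF mono kn d M_def r] A'(6)[OF t r] affine_base_out[of r l q x s]
          False rhs by (simp add: K_def)
    qed
  qed
  moreover have "y \<in> X"
    using X affine_cube_image[OF A] ecube_nonempty[of n "affine_base q x l s" "l ` {..<q}"]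
    by (auto simp: y_def)
  moreover have "embedding_matrix n q M"
    using mono kn by (auto simp: embedding_matrix_def M_def)
  moreover have "z \<in> Icube q" by (auto simp: z_def Icube_def)
  ultimately show ?thesis using p unfolding standard_form_def by blast
qed

text \<open>Every standard form of \<open>\<sigma>\<close> is affine with the same \<open>l\<close>
  and \<open>s\<close>, hence yields the same sign.\<close>

lemma orientation_affine:
  assumes A: "affine_cube n q \<sigma> x l s" and X: "\<sigma> ` Icube q \<subseteq> X" "X \<subseteq> carrier_vec n"
  shows "orientation n X q \<sigma> = (\<Prod>j<q. s j) * inv_sign q l"
proof -
  have eq: "(-1) ^ card {i. i < q \<and> z $ i \<noteq> 0} * sign p = (\<Prod>j<q. s j) * inv_sign q l"
    if sf: "standard_form n X q \<sigma> M z p y" for M z p y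
  proof -
    obtain x' l' s' where A': "affine_cube n q \<sigma> x' l' s'"
      and e: "(-1) ^ card {i. i < q \<and> z $ i \<noteq> 0} * sign p = (\<Prod>j<q. s' j) * inv_sign q l'"
      using standard_form_affine[OF sf X(2)] by metis
    have "inv_sign q l' = inv_sign q l" "(\<Prod>j<q. s' j) = (\<Prod>j<q. s j)"
      using affine_cube_unique[OF A' A] by (auto intro: inv_sign_cong)
    then show ?thesis using e by simp
  qed
  obtain M z p y where sf: "standard_form n X q \<sigma> M z p y"
    using affine_standard_form[OF A X(1)] by blast
  show ?thesis
    unfolding orientation_def
  proof (rule the_equality)
    show "\<exists>M z p y. standard_form n X q \<sigma> M z p y \<and>
        (\<Prod>j<q. s j) * inv_sign q l = (-1) ^ card {i. i < q \<and> z $ i \<noteq> 0} * sign p"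
      using sf eq[OF sf, symmetric] by blast
  qed (use eq in auto)
qed

lemma beta_dQ_affine:
  assumes "affine_cube n q \<sigma> x l s" "\<sigma> ` Icube q \<subseteq> X" "X \<subseteq> carrier_vec n"
  shows "beta_dQ n X q (frag_of \<sigma>) = frag_cmul ((\<Prod>j<q. s j) * inv_sign q l)
    (frag_of (ecube n (affine_base q x l s) (l ` {..<q})))"
  using affine_cube_inj[OF assms(1)] orientation_affine[OF assms] affine_cube_image[OF assms(1)]
  by (simp add: beta_dQ_def)


subsection \<open>The chain map property on affine cubes\<close>

lemma face_affine:
  assumes A: "affine_cube n (Suc q) \<sigma> x l s" and i: "i < Suc q" and e: "e \<in> {0, 1}"
  shows "affine_cube n q (\<lambda>t\<in>Icube (Suc q - 1). \<sigma> (insert_coord i e t))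
    (x(l i := x (l i) + s i * e)) (l \<circ> skip i) (s \<circ> skip i)"
proof -
  note A' = affine_cubeD[OF A]
  note bij = bij_betw_skip[OF i]
  have sk: "skip i j < Suc q" "skip i j \<noteq> i" if "j < q" for j
    using bij_betwE[OF bij] that by auto
  have ne: "l (skip i j) \<noteq> l i" if "j < q" for j
    using sk[OF that] inj_on_eq_iff[OF A'(1)] i by simp
  have ins: "insert_coord i e t $ skip i j = t $ j"
    if "t \<in> Icube q" "j < q" for t j
    using that i by (auto simp: insert_coord_def skip_def Icube_def)
  have ins_i: "insert_coord i e t $ i = e" if "t \<in> Icube q" for t
    using that i by (auto simp: insert_coord_def Icube_def)
  have I: "insert_coord i e t \<in> Icube (Suc q)" if "t \<in> Icube q" for t
    using insert_coord_Icube[of t "Suc q"] that i e by simp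
  have im: "k = l i \<or> k \<notin> l ` {..<Suc q}" if "k \<notin> (l \<circ> skip i) ` {..<q}" for k
    using that bij_betw_imp_surj_on[OF bij] unfolding image_comp[symmetric] by auto
  show ?thesis
    unfolding affine_cube_def
  proof (intro conjI ballI allI impI)
    show "inj_on (l \<circ> skip i) {..<q}"
      using bij A'(1) by (intro comp_inj_on) (auto simp: bij_betw_def intro: inj_on_subset)
    show "(l \<circ> skip i) ` {..<q} \<subseteq> {..<n}" using sk A'(2) by auto
    show "(s \<circ> skip i) j \<in> {1, -1}" if "j < q" for j using A'(3)[OF sk(1)[OF that]] by auto
  next
    fix t assume t: "t \<in> Icube q"
    let ?f = "\<lambda>t\<in>Icube (Suc q - 1). \<sigma> (insert_coord i e t)"
    have f: "?f t = \<sigma> (insert_coord i e t)" using t by simp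
    show "?f t \<in> carrier_vec n" using A'(4)[OF I[OF t]] f by simp
    show "?f t $ (l \<circ> skip i) j = (x(l i := x (l i) + s i * e)) ((l \<circ> skip i) j) + (s \<circ> skip i) j * t $ j"
      if j: "j < q" for j
      using A'(5)[OF I[OF t] sk(1)[OF j]] f ne[OF j] ins[OF t j] by simp
    show "?f t $ k = (x(l i := x (l i) + s i * e)) k" if k: "k < n" "k \<notin> (l \<circ> skip i) ` {..<q}" for k
    proof (cases "k = l i")
      case True
      then show ?thesis using A'(5)[OF I[OF t] i] f ins_i[OF t] by simp
    next
      case False
      then show ?thesis using A'(6)[OF I[OF t] k(1)] im[OF k(2)] f by simp
    qed
  qed
qed

lemma affine_base_face:
  assumes l: "inj_on l {..<Suc q}" and i: "i < Suc q"
  shows "affine_base q (x(l i := c)) (l \<circ> skip i) (s \<circ> skip i) = (affine_base (Suc q) x l s)(l i := c)"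
proof
  fix k
  have sk: "skip i ` {..<q} = {..<Suc q} - {i}"
    using bij_betw_imp_surj_on[OF bij_betw_skip[OF i]] .
  have "(\<exists>j<q. l (skip i j) = k \<and> s (skip i j) = -1) \<longleftrightarrow> (\<exists>j\<in>skip i ` {..<q}. l j = k \<and> s j = -1)"
    by auto
  also have "\<dots> \<longleftrightarrow> k \<noteq> l i \<and> (\<exists>j<Suc q. l j = k \<and> s j = -1)"
    unfolding sk using inj_on_eq_iff[OF l] i by auto
  finally show "affine_base q (x(l i := c)) (l \<circ> skip i) (s \<circ> skip i) k =
      ((affine_base (Suc q) x l s)(l i := c)) k"
    unfolding affine_base_def by auto
qed

lemma beta_face_affine:
  assumes A: "affine_cube n (Suc q) \<sigma> x l s" and \<sigma>: "\<sigma> ` Icube (Suc q) \<subseteq> X" and X: "X \<subseteq> carrier_vec n"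
    and i: "i < Suc q" and e: "e \<in> {0, 1}"
  shows "beta_dQ n X q (frag_of (\<lambda>t\<in>Icube (Suc q - 1). \<sigma> (insert_coord i e t))) =
    frag_cmul ((\<Prod>j<q. s (skip i j)) * inv_sign q (l \<circ> skip i))
      (frag_of (ecube n ((affine_base (Suc q) x l s)(l i := x (l i) + s i * e)) (l ` {..<Suc q} - {l i})))"
proof -
  note A' = affine_cubeD[OF A]
  let ?f = "\<lambda>t\<in>Icube (Suc q - 1). \<sigma> (insert_coord i e t)"
  have "?f ` Icube q \<subseteq> X"
    using \<sigma> insert_coord_Icube[of _ "Suc q" i e] i e by auto
  moreover have "(l \<circ> skip i) ` {..<q} = l ` {..<Suc q} - {l i}"
  proof -
    have "(l \<circ> skip i) ` {..<q} = l ` ({..<Suc q} - {i})"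
      using bij_betw_imp_surj_on[OF bij_betw_skip[OF i]] by (metis image_comp)
    then show ?thesis using inj_on_image_set_diff[OF A'(1), of "{..<Suc q}" "{i}"] i by simp
  qed
  ultimately show ?thesis
    using beta_dQ_affine[OF face_affine[OF A i e] _ X] affine_base_face[OF A'(1) i] by simp
qed

text \<open>The sums match term by term: index \<open>i\<close> on the singular side corresponds to
  direction \<open>k = l i\<close> on the elementary side.\<close>

lemma beta_boundary_affine:
  assumes A: "affine_cube n (Suc q) \<sigma> x l s" and \<sigma>: "\<sigma> ` Icube (Suc q) \<subseteq> X" and X: "X \<subseteq> carrier_vec n"
  shows "beta_dQ n X q (boundary_dQ (Suc q) (frag_of \<sigma>)) =
    boundary_c1 n (Suc q) (beta_dQ n X (Suc q) (frag_of \<sigma>))"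
proof -
  note A' = affine_cubeD[OF A]
  define b where "b = affine_base (Suc q) x l s"
  define K where "K = l ` {..<Suc q}"
  define o\<sigma> where "o\<sigma> = (\<Prod>j<Suc q. s j) * inv_sign (Suc q) l"
  define F where "F = (\<lambda>k. frag_of (ecube n b (K - {k})) - frag_of (ecube n (b(k := b k + 1)) (K - {k})))"
  have K: "K \<subseteq> {..<n}" "card K = Suc q"
    using A'(1,2) by (auto simp: K_def card_image)
  have face: "beta_dQ n X q (frag_cmul ((-1) ^ (i + 1))
        (frag_of (face_A (Suc q) i \<sigma>) - frag_of (face_B (Suc q) i \<sigma>))) =
      frag_cmul (o\<sigma> * (-1) ^ (card {k \<in> K. k < l i} + 1)) (F (l i))" if i: "i < Suc q" for i
  proof -
    define c where "c = (\<Prod>j<q. s (skip i j)) * inv_sign q (l \<circ> skip i)"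
    \<comment> \<open>If \<open>s i = -1\<close>, the face at 0 is the upper one, so the two faces
      trade places; this accounts for the factor \<open>s i\<close> below.\<close>
    have b: "b(l i := x (l i)) = (if s i = 1 then b else b(l i := b (l i) + 1))"
      "b(l i := x (l i) + s i) = (if s i = 1 then b(l i := b (l i) + 1) else b)"
      using affine_base_in[OF A'(1) i, of x s] A'(3)[OF i] by (auto simp: b_def)
    have "beta_dQ n X q (frag_of (face_A (Suc q) i \<sigma>) - frag_of (face_B (Suc q) i \<sigma>)) =
        frag_cmul c (frag_of (ecube n (b(l i := x (l i))) (K - {l i}))) -
        frag_cmul c (frag_of (ecube n (b(l i := x (l i) + s i)) (K - {l i})))"
      using beta_face_affine[OF A \<sigma> X i, of 0] beta_face_affine[OF A \<sigma> X i, of 1]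
      unfolding face_A_def face_B_def b_def K_def c_def
      by (simp add: beta_dQ_def frag_extend_diff)
    also have "\<dots> = frag_cmul (c * s i) (F (l i))"
      unfolding b F_def using A'(3)[OF i] by (auto simp: poly_mapping_eqI lookup_minus right_diff_distrib)
    finally have "beta_dQ n X q (frag_cmul ((-1) ^ (i + 1))
        (frag_of (face_A (Suc q) i \<sigma>) - frag_of (face_B (Suc q) i \<sigma>))) =
        frag_cmul ((-1) ^ (i + 1) * (c * s i)) (F (l i))"
      unfolding beta_dQ_def frag_extend_cmul by simp
    \<comment> \<open>\<open>inv_sign_delete\<close> turns \<open>(-1) ^ i\<close> into the sign of
      the rank, which can be moved across because its square is 1.\<close>
    also have "(-1) ^ (i + 1) * (c * s i) = o\<sigma> * (-1) ^ (card {k \<in> K. k < l i} + 1)"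
    proof -
      have "(\<Prod>j<Suc q. s j) = s i * prod s ({..<Suc q} - {i})"
        using i by (subst prod.remove[of _ i]) auto
      also have "prod s ({..<Suc q} - {i}) = (\<Prod>j<q. s (skip i j))"
        by (rule prod.reindex_bij_betw[OF bij_betw_skip[OF i], symmetric])
      finally have "o\<sigma> = c * s i * (-1) ^ i * (-1) ^ card {k \<in> K. k < l i}"
        unfolding o\<sigma>_def c_def inv_sign_delete[OF A'(1) i] K_def by (simp only: mult_ac)
      moreover have "(-1::int) ^ card {k \<in> K. k < l i} * (-1) ^ card {k \<in> K. k < l i} = 1"
        by (simp flip: power_mult_distrib)
      ultimately show ?thesis by (simp add: mult_ac)
    qed
    finally show ?thesis .
  qed
  have "beta_dQ n X q (boundary_dQ (Suc q) (frag_of \<sigma>)) =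
      (\<Sum>i<Suc q. beta_dQ n X q (frag_cmul ((-1) ^ (i + 1))
        (frag_of (face_A (Suc q) i \<sigma>) - frag_of (face_B (Suc q) i \<sigma>))))"
    unfolding boundary_dQ_def beta_dQ_def frag_extend_of by (subst frag_extend_sum) (simp_all only: o_def finite_lessThan)
  also have "\<dots> = (\<Sum>i<Suc q. frag_cmul (o\<sigma> * (-1) ^ (card {k \<in> K. k < l i} + 1)) (F (l i)))"
    by (intro sum.cong refl face) simp
  also have "\<dots> = (\<Sum>k\<in>K. frag_cmul (o\<sigma> * (-1) ^ (card {j \<in> K. j < k} + 1)) (F k))"
    unfolding K_def by (subst sum.reindex[OF A'(1)]) (simp only: o_def)
  also have "\<dots> = frag_cmul o\<sigma> (boundary_c1 n (Suc q) (frag_of (ecube n b K)))"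
    using boundary_c1_ecube[OF K(1), of b] by (simp add: K(2) F_def frag_cmul_sum)
  also have "\<dots> = boundary_c1 n (Suc q) (beta_dQ n X (Suc q) (frag_of \<sigma>))"
    unfolding beta_dQ_affine[OF A \<sigma> X] o\<sigma>_def b_def K_def by (simp only: boundary_c1_def frag_extend_cmul)
  finally show ?thesis .
qed


subsection \<open>Noninjective cubes\<close>

lemma insert_coord_insert_coord:
  assumes "i \<le> j" "j \<le> dim_vec t"
  shows "insert_coord i e (insert_coord j f t) = insert_coord (Suc j) f (insert_coord i e t)"
  by (rule eq_vecI) (use assms in \<open>auto simp: insert_coord_def\<close>)

text \<open>Covers \<open>face_A\<close> (\<open>e = 0\<close>) and \<open>face_B\<close>
  (\<open>e = 1\<close>) at once, so that the cubical identity takes a single statement.\<close>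

definition face :: "nat \<Rightarrow> nat \<Rightarrow> int \<Rightarrow> (int vec \<Rightarrow> int vec) \<Rightarrow> int vec \<Rightarrow> int vec" where
  "face q i e \<sigma> = (\<lambda>t\<in>Icube (q - 1). \<sigma> (insert_coord i e t))"

lemma face_face:
  assumes "i \<le> j" "j < q" "e \<in> {0, 1}" "f \<in> {0, 1}"
  shows "face q j f (face (Suc q) i e \<sigma>) = face q i e (face (Suc q) (Suc j) f \<sigma>)"
  unfolding face_def
proof (rule restrict_ext)
  fix t assume t: "t \<in> Icube (q - 1)"
  have "insert_coord j f t \<in> Icube q" "insert_coord i e t \<in> Icube q"
    using insert_coord_Icube[OF t] assms by auto
  moreover have "j \<le> dim_vec t" using t assms(2) by (auto simp: Icube_def)
  ultimately show "(\<lambda>t\<in>Icube (Suc q - 1). \<sigma> (insert_coord i e t)) (insert_coord j f t) =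
      (\<lambda>t\<in>Icube (Suc q - 1). \<sigma> (insert_coord (Suc j) f t)) (insert_coord i e t)"
    using insert_coord_insert_coord[OF assms(1)] by simp
qed

text \<open>The classical cancellation, already valid before degenerate cubes are divided out: each
  iterated face arises in two orders, with opposite signs.\<close>

lemma boundary_dQ_boundary_dQ: "boundary_dQ q (boundary_dQ (Suc q) c) = 0"
proof -
  have bd: "boundary_dQ q (frag_of \<sigma>) =
      (\<Sum>i<q. frag_cmul ((-1) ^ (i + 1)) (frag_of (face q i 0 \<sigma>) - frag_of (face q i 1 \<sigma>)))" for q \<sigma>
    by (simp add: boundary_dQ_def face_A_def face_B_def face_def)
  have lin: "boundary_dQ q (frag_cmul a (x - y)) = frag_cmul a (boundary_dQ q x - boundary_dQ q y)" for a x y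
    by (simp add: boundary_dQ_def frag_extend_cmul frag_extend_diff)
  have "boundary_dQ q (boundary_dQ (Suc q) (frag_of \<sigma>)) = 0" for \<sigma>
  proof -
    define G where "G = (\<lambda>i j e f. frag_of (face q j f (face (Suc q) i e \<sigma>)))"
    define T where "T = (\<lambda>(i, j). frag_cmul ((-1) ^ (i + 1) * (-1) ^ (j + 1))
      (G i j 0 0 - G i j 0 1 - (G i j 1 0 - G i j 1 1)))"
    have "boundary_dQ q (boundary_dQ (Suc q) (frag_of \<sigma>)) = (\<Sum>i<Suc q. boundary_dQ q
        (frag_cmul ((-1) ^ (i + 1)) (frag_of (face (Suc q) i 0 \<sigma>) - frag_of (face (Suc q) i 1 \<sigma>))))"
      unfolding bd[of "Suc q"] by (subst (1 2) boundary_dQ_def, subst frag_extend_sum) (simp_all only: o_def finite_lessThan)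
    also have "\<dots> = (\<Sum>i<Suc q. \<Sum>j<q. T (i, j))"
    proof (rule sum.cong[OF refl])
      fix i
      have "frag_cmul a (frag_cmul b x - frag_cmul b y) = frag_cmul (a * b) (x - y)"
        for a b and x y :: "(int vec \<Rightarrow> int vec) \<Rightarrow>\<^sub>0 int"
        by (rule poly_mapping_eqI) (simp add: lookup_minus algebra_simps)
      then show "boundary_dQ q (frag_cmul ((-1) ^ (i + 1))
          (frag_of (face (Suc q) i 0 \<sigma>) - frag_of (face (Suc q) i 1 \<sigma>))) = (\<Sum>j<q. T (i, j))"
        unfolding lin bd sum_subtractf[symmetric] frag_cmul_sum T_def G_def prod.case by simp
    qed
    also have "\<dots> = sum T ({..<Suc q} \<times> {..<q})"
      by (subst sum.cartesian_product) simp
    also have "{..<Suc q} \<times> {..<q} = {(i, j). i \<le> j \<and> j < q} \<union> {(i, j). j < i \<and> i < Suc q}"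
      by auto
    also have "sum T \<dots> = sum T {(i, j). i \<le> j \<and> j < q} + sum T {(i, j). j < i \<and> i < Suc q}"
    proof (rule sum.union_disjoint)
      show "finite {(i, j). i \<le> j \<and> j < q}" by (rule finite_subset[of _ "{..<q} \<times> {..<q}"]) auto
      show "finite {(i, j). j < i \<and> i < Suc q}" by (rule finite_subset[of _ "{..<Suc q} \<times> {..<Suc q}"]) auto
    qed auto
    \<comment> \<open>Fixing coordinate \<open>i\<close> first shifts coordinate
      \<open>Suc j\<close> down to \<open>j\<close>, so the pair \<open>(i, j)\<close> in the other
      order is \<open>(Suc j, i)\<close>.\<close>
    also have "sum T {(i, j). j < i \<and> i < Suc q} = (\<Sum>(i, j)\<in>{(i, j). i \<le> j \<and> j < q}. T (Suc j, i))"
      by (rule sum.reindex_bij_witness[of _ "\<lambda>(i, j). (Suc j, i)" "\<lambda>(i, j). (j, i - 1)"]) auto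
    also have "\<dots> = (\<Sum>x\<in>{(i, j). i \<le> j \<and> j < q}. - T x)"
    proof (rule sum.cong[OF refl])
      fix x assume "x \<in> {(i, j). i \<le> j \<and> j < q}"
      then obtain i j where x: "x = (i, j)" "i \<le> j" "j < q" by auto
      \<comment> \<open>Swapping \<open>e\<close> and \<open>f\<close> leaves the alternating
        combination in \<open>T\<close> unchanged, while the exponent of the sign grows by
        one.\<close>
      have "G (Suc j) i e f = G i j f e" if "e \<in> {0, 1}" "f \<in> {0, 1}" for e f
        using face_face[OF x(2,3) that(2,1)] by (simp add: G_def)
      then have "T (Suc j, i) = - T (i, j)"
        by (simp add: T_def) (simp add: poly_mapping_eqI lookup_minus lookup_add algebra_simps)
      then show "(case x of (i, j) \<Rightarrow> T (Suc j, i)) = - T x" using x(1) by simp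
    qed
    finally show ?thesis by (simp add: sum_negf)
  qed
  then show ?thesis
    unfolding boundary_dQ_def frag_extend_frag_extend by (simp add: frag_extend_eq_0)
qed

lemma beta_dQ_expand: "beta_dQ n X q c = frag_extend (\<lambda>\<sigma>. beta_dQ n X q (frag_of \<sigma>)) c"
  by (simp add: beta_dQ_def)

lemma beta_dQ_keys:
  assumes "Q \<in> Poly_Mapping.keys (beta_dQ n X q (frag_of \<sigma>))" "\<sigma> \<in> singular_cubes X q" "X \<subseteq> carrier_vec n"
  shows "Q = \<sigma> ` Icube q" "Q \<in> elementary_cubes n q"
proof -
  have inj: "inj_on \<sigma> (Icube q)" and Q: "Q = \<sigma> ` Icube q"
    using assms(1) by (auto simp: beta_dQ_def split: if_splits)
  obtain x l s where A: "affine_cube n q \<sigma> x l s"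
    using injective_cube_affine[OF assms(2,3) inj] .
  then have "l ` {..<q} \<subseteq> {..<n}" "card (l ` {..<q}) = q"
    using affine_cubeD(1,2)[OF A] by (auto simp: card_image)
  then show "Q = \<sigma> ` Icube q" "Q \<in> elementary_cubes n q"
    using Q affine_cube_image[OF A] unfolding elementary_cubes_eq by blast+
qed

lemma noninjective_image_card:
  assumes "\<not> inj_on \<sigma> (Icube q)"
  shows "finite (\<sigma> ` Icube q)" "card (\<sigma> ` Icube q) < 2 ^ q"
proof -
  have "Icube q \<subseteq> vertex q ` Pow {..<q}"
    using Icube_vertex by (auto intro!: image_eqI)
  then have fin: "finite (Icube q)" and card: "card (Icube q) \<le> 2 ^ q"
    using card_image_le[of "Pow {..<q}" "vertex q"] card_mono[of "vertex q ` Pow {..<q}" "Icube q"]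
    by (auto intro: finite_subset simp: card_Pow)
  then show "finite (\<sigma> ` Icube q)" "card (\<sigma> ` Icube q) < 2 ^ q"
    using card_image_le[OF fin, of \<sigma>] eq_card_imp_inj_on[OF fin, of \<sigma>] assms by fastforce+
qed

text \<open>\<open>IH\<close> is the chain map property one dimension lower, for arbitrary chains
  because it is applied to the boundary of \<open>\<sigma>\<close>. It makes \<open>w\<close> a
  cycle when \<open>\<sigma>\<close> is noninjective.\<close>

lemma beta_boundary_generator:
  assumes X: "X \<subseteq> carrier_vec n" and \<sigma>: "\<sigma> \<in> singular_cubes X (Suc q)"
    and IH: "\<And>p c. q = Suc p \<Longrightarrow> c \<in> carrier (dQ X q) \<Longrightarrow>
      beta_dQ n X p (boundary_dQ q c) = boundary_c1 n q (beta_dQ n X q c)"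
  shows "beta_dQ n X q (boundary_dQ (Suc q) (frag_of \<sigma>)) =
    boundary_c1 n (Suc q) (beta_dQ n X (Suc q) (frag_of \<sigma>))"
proof (cases "inj_on \<sigma> (Icube (Suc q))")
  case True
  obtain x l s where "affine_cube n (Suc q) \<sigma> x l s"
    using injective_cube_affine[OF \<sigma> X True] .
  then show ?thesis
    using \<sigma> X by (intro beta_boundary_affine) (auto simp: singular_cubes_def c1_continuous_def)
next
  case False
  define c where "c = boundary_dQ (Suc q) (frag_of \<sigma>)"
  define w where "w = beta_dQ n X q c"
  have "w = 0"
  proof (cases q)
    \<comment> \<open>The vertex bound for cycles starts in dimension 1, so 1-cubes are treated
      directly: a noninjective one is constant and its end points cancel.\<close>
    case 0
    have vert: "t = vertex 1 {} \<or> t = vertex 1 {0}" if t: "t \<in> Icube 1" for t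
    proof -
      have "{j. j < 1 \<and> t $ j = 1} = {} \<or> {j. j < 1 \<and> t $ j = 1} = {0}" by auto
      then show ?thesis using Icube_vertex[OF t] by metis
    qed
    obtain t u where "t \<in> Icube 1" "u \<in> Icube 1" "t \<noteq> u" "\<sigma> t = \<sigma> u"
      using False 0 by (auto simp: inj_on_def)
    then have const: "\<sigma> v = \<sigma> (vertex 1 {})" if "v \<in> Icube 1" for v
      using vert[of t] vert[of u] vert[OF that] by metis
    have "face_A 1 0 \<sigma> = face_B 1 0 \<sigma>"
      unfolding face_A_def face_B_def
    proof (rule restrict_ext)
      fix t assume "t \<in> Icube (1 - 1)"
      then have "insert_coord 0 0 t \<in> Icube 1" "insert_coord 0 1 t \<in> Icube 1"
        by (intro insert_coord_Icube; simp)+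
      then show "\<sigma> (insert_coord 0 0 t) = \<sigma> (insert_coord 0 1 t)"
        using const by metis
    qed
    then have "c = 0" using 0 by (simp add: c_def boundary_dQ_def)
    then show ?thesis by (simp add: w_def beta_dQ_def)
  next
    case (Suc p)
    have c_carrier: "c \<in> carrier (dQ X q)"
      using boundary_dQ_carrier[of "frag_of \<sigma>" X "Suc q"] \<sigma> by (simp add: c_def dQ_def)
    have "boundary_c1 n q w = beta_dQ n X p (boundary_dQ q c)"
      using IH[OF Suc c_carrier] by (simp add: w_def)
    then have cycle: "boundary_c1 n q w = 0"
      by (simp add: c_def boundary_dQ_boundary_dQ beta_dQ_def)
    have faces: "\<exists>i<Suc q. \<tau> = face_A (Suc q) i \<sigma> \<or> \<tau> = face_B (Suc q) i \<sigma>"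
      if \<tau>: "\<tau> \<in> Poly_Mapping.keys c" for \<tau>
    proof -
      obtain i where "i < Suc q" "\<tau> \<in> Poly_Mapping.keys (frag_cmul ((-1) ^ (i + 1))
          (frag_of (face_A (Suc q) i \<sigma>) - frag_of (face_B (Suc q) i \<sigma>)))"
        using subsetD[OF keys_sum \<tau>[unfolded c_def boundary_dQ_def frag_extend_of]] by blast
      then show ?thesis
        using keys_diff[of "frag_of (face_A (Suc q) i \<sigma>)" "frag_of (face_B (Suc q) i \<sigma>)"] by auto
    qed
    have keys: "Q \<in> elementary_cubes n q \<and> Q \<subseteq> \<sigma> ` Icube (Suc q)" if Q: "Q \<in> Poly_Mapping.keys w" for Q
    proof -
      obtain \<tau> where \<tau>: "\<tau> \<in> Poly_Mapping.keys c" "Q \<in> Poly_Mapping.keys (beta_dQ n X q (frag_of \<tau>))"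
        using Q keys_frag_extend unfolding w_def beta_dQ_expand[of n X q c] by fast
      have "\<tau> \<in> singular_cubes X q" using c_carrier \<tau>(1) by (auto simp: dQ_def)
      note Q' = beta_dQ_keys[OF \<tau>(2) this X]
      obtain i where i: "i < Suc q" "\<tau> = face_A (Suc q) i \<sigma> \<or> \<tau> = face_B (Suc q) i \<sigma>"
        using faces[OF \<tau>(1)] by blast
      have "\<tau> t \<in> \<sigma> ` Icube (Suc q)" if t: "t \<in> Icube q" for t
      proof -
        have "insert_coord i 0 t \<in> Icube (Suc q)" "insert_coord i 1 t \<in> Icube (Suc q)"
          using insert_coord_Icube[of t "Suc q" i] i(1) t by auto
        then show ?thesis using i(2) t by (auto simp: face_A_def face_B_def)
      qed
      then show ?thesis using Q' by blast
    qed
    show "w = 0"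
    proof (rule ccontr)
      assume "w \<noteq> 0"
      \<comment> \<open>A cycle in dimension \<open>q = Suc p\<close> has at least
        \<open>2 ^ (p + 2)\<close> vertices, one more than the largest number of values below
        injectivity on \<open>Icube (Suc q)\<close>.\<close>
      then have "2 ^ Suc q \<le> card (\<Union>(Poly_Mapping.keys w))"
        using cycle_vertices[of w n p] keys cycle Suc by auto
      also have "\<dots> \<le> card (\<sigma> ` Icube (Suc q))"
        using keys noninjective_image_card(1)[OF False] by (intro card_mono) auto
      also have "\<dots> < 2 ^ Suc q" by (rule noninjective_image_card(2)[OF False])
      finally show False by simp
    qed
  qed
  then show ?thesis using False by (simp add: w_def c_def beta_dQ_def boundary_c1_def)
qed


subsection \<open>The chain map property\<close>

lemma beta_boundary_extend:
  assumes c: "c \<in> carrier (dQ X (Suc q))"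
    and gen: "\<And>\<sigma>. \<sigma> \<in> singular_cubes X (Suc q) \<Longrightarrow>
      beta_dQ n X q (boundary_dQ (Suc q) (frag_of \<sigma>)) = boundary_c1 n (Suc q) (beta_dQ n X (Suc q) (frag_of \<sigma>))"
  shows "beta_dQ n X q (boundary_dQ (Suc q) c) = boundary_c1 n (Suc q) (beta_dQ n X (Suc q) c)"
proof -
  have "beta_dQ n X q (boundary_dQ (Suc q) c) =
      frag_extend (\<lambda>\<sigma>. beta_dQ n X q (boundary_dQ (Suc q) (frag_of \<sigma>))) c"
    by (simp add: beta_dQ_def boundary_dQ_def frag_extend_frag_extend)
  also have "\<dots> = frag_extend (\<lambda>\<sigma>. boundary_c1 n (Suc q) (beta_dQ n X (Suc q) (frag_of \<sigma>))) c"
    using c by (intro frag_extend_eq gen) (auto simp: dQ_def)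
  also have "\<dots> = boundary_c1 n (Suc q) (beta_dQ n X (Suc q) c)"
    by (simp add: beta_dQ_def boundary_c1_def frag_extend_frag_extend)
  finally show ?thesis .
qed

text \<open>The induction runs over all chains \<open>c\<close>, since the generator step needs the
  previous dimension for a boundary and not only for a single cube.\<close>

lemma beta_boundary:
  assumes X: "X \<subseteq> carrier_vec n" and "c \<in> carrier (dQ X (Suc q))"
  shows "beta_dQ n X q (boundary_dQ (Suc q) c) = boundary_c1 n (Suc q) (beta_dQ n X (Suc q) c)"
  using assms(2)
proof (induction q arbitrary: c)
  case 0
  show ?case
  proof (rule beta_boundary_extend[OF 0])
    fix \<sigma> assume "\<sigma> \<in> singular_cubes X (Suc 0)"
    then show "beta_dQ n X 0 (boundary_dQ (Suc 0) (frag_of \<sigma>)) =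
        boundary_c1 n (Suc 0) (beta_dQ n X (Suc 0) (frag_of \<sigma>))"
      by (rule beta_boundary_generator[OF X]) simp
  qed
next
  case (Suc q)
  show ?case
  proof (rule beta_boundary_extend[OF Suc.prems])
    fix \<sigma> assume "\<sigma> \<in> singular_cubes X (Suc (Suc q))"
    then show "beta_dQ n X (Suc q) (boundary_dQ (Suc (Suc q)) (frag_of \<sigma>)) =
        boundary_c1 n (Suc (Suc q)) (beta_dQ n X (Suc (Suc q)) (frag_of \<sigma>))"
      by (rule beta_boundary_generator[OF X]) (metis Suc.IH nat.inject)
  qed
qed

lemma beta_dQ_carrier:
  assumes "X \<subseteq> carrier_vec n" "c \<in> carrier (dQ X q)"
  shows "beta_dQ n X q c \<in> carrier (C_c1 n X q)"
proof -
  have "Q \<in> elementary_cubes n q \<and> Q \<subseteq> X" if Q: "Q \<in> Poly_Mapping.keys (beta_dQ n X q c)" for Q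
  proof -
    obtain \<sigma> where \<sigma>: "\<sigma> \<in> Poly_Mapping.keys c" "Q \<in> Poly_Mapping.keys (beta_dQ n X q (frag_of \<sigma>))"
      using Q keys_frag_extend unfolding beta_dQ_expand[of n X q c] by fast
    have "\<sigma> \<in> singular_cubes X q" using assms(2) \<sigma>(1) by (auto simp: dQ_def)
    then show ?thesis using beta_dQ_keys[OF \<sigma>(2) _ assms(1)]
      by (auto simp: singular_cubes_def c1_continuous_def)
  qed
  then show ?thesis by (auto simp: C_c1_def)
qed

theorem theorem6p8:
  fixes n :: nat and X :: "int vec set"
  assumes "X \<subseteq> carrier_vec n"
  shows "(\<forall>q. beta n X q \<in> hom (dC X q) (C_c1 n X q)) \<and>
    (\<forall>q\<ge>1. \<forall>c \<in> carrier (dC X q).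
       beta n X (q - 1) (boundary_dC X q c) = boundary_c1 n q (beta n X q c))"
proof (intro conjI allI impI ballI)
  \<comment> \<open>Every element of the quotient has a representative; \<open>beta_coset\<close>
    and \<open>boundary_dC_coset\<close> then reduce both claims to chains in
    \<open>dQ X q\<close>.\<close>
  have coset: "\<exists>c\<in>carrier (dQ X q). K = dD X q #>\<^bsub>dQ X q\<^esub> c" if "K \<in> carrier (dC X q)" for q K
    using that by (auto simp: dC_def FactGroup_def RCOSETS_def)
  fix q
  show "beta n X q \<in> hom (dC X q) (C_c1 n X q)"
  proof (rule homI)
    fix K L assume "K \<in> carrier (dC X q)" "L \<in> carrier (dC X q)"
    then obtain a b where a: "a \<in> carrier (dQ X q)" "K = dD X q #>\<^bsub>dQ X q\<^esub> a"
      and b: "b \<in> carrier (dQ X q)" "L = dD X q #>\<^bsub>dQ X q\<^esub> b" using coset by metis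
    then show "beta n X q K \<in> carrier (C_c1 n X q)"
      using beta_dQ_carrier[OF assms] by (simp add: beta_coset)
    have "K \<otimes>\<^bsub>dC X q\<^esub> L = dD X q #>\<^bsub>dQ X q\<^esub> (a \<otimes>\<^bsub>dQ X q\<^esub> b)"
      using normal.rcos_sum[OF dD_normal a(1) b(1)] a(2) b(2) by (simp add: dC_def)
    then have "beta n X q (K \<otimes>\<^bsub>dC X q\<^esub> L) = beta_dQ n X q (a + b)"
      by (simp add: beta_coset) (simp add: dQ_def)
    then show "beta n X q (K \<otimes>\<^bsub>dC X q\<^esub> L) = beta n X q K \<otimes>\<^bsub>C_c1 n X q\<^esub> beta n X q L"
      by (simp add: a(2) b(2) beta_coset C_c1_def) (simp add: beta_dQ_def frag_extend_add)
  qed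
  fix K assume "1 \<le> q" "K \<in> carrier (dC X q)"
  then obtain p c where "q = Suc p" and c: "c \<in> carrier (dQ X q)" "K = dD X q #>\<^bsub>dQ X q\<^esub> c"
    using coset by (metis Suc_diff_1 less_eq_Suc_le One_nat_def)
  then show "beta n X (q - 1) (boundary_dC X q K) = boundary_c1 n q (beta n X q K)"
    using beta_boundary[OF assms, of c p] by (simp add: boundary_dC_coset beta_coset)
qed

end
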